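(* Consider the Active Target Defense Differential Game (ATDDG) described in the context, with speed ratio $0\le\alpha<1$ and reduced state $(x_A,x_T,y_T)$, where, without loss of generality, $x_A>0$ and $y_T\ge0$. In the part of the state space where the Target can escape, the optimal headings of the Attacker ($\chi^*$), the Target ($\phi^*$), and the Defender ($\psi^*$) are given by the state feedback control laws $$\cos\phi^*=\pm\frac{x_T}{\sqrt{x_T^2+(y_T-y)^2}},\qquad \sin\phi^*=\pm\frac{y_T-y}{\sqrt{x_T^2+(y_T-y)^2}}\qquad\text{for }x_T\ne0,$$ $$\cos\chi^*=-\frac{x_A}{\sqrt{x_A^2+y^2}},\quad \sin\chi^*=\frac{y}{\sqrt{x_A^2+y^2}},\qquad \cos\psi^*=\frac{x_A}{\sqrt{x_A^2+y^2}},\quad \sin\psi^*=\frac{y}{\sqrt{x_A^2+y^2}},$$ where $y$ is a real solution of the quartic equation $$(1-\alpha^2)y^4-2(1-\alpha^2)y_Ty^3+\big[(1-\alpha^2)y_T^2+x_A^2-\alpha^2x_T^2\big]y^2-2x_A^2y_Ty+x_A^2y_T^2=0,$$ which is parameterized by the speed ratio $0\le\alpha<1$. The quartic equation has two real solutions $y_1$ and $y_2$, and $y_1\le y_T\le y_2$. In the control laws, the solution $y=y_1$ is selected when $x_T\le0$ and the solution $y=y_2$ is used when $x_T>0$. Also, the sign in the Target heading is positive when $x_T<0$ and negative when $x_T>0$. Finally, when $x_T=0$, the Target's optimal heading $\phi^*$ is given by $$\phi^*=\varphi^*+\frac{\pi}{2},\qquad\text{where}\quad \tan\varphi^*=\frac{\sqrt{x_A^2+(1-\alpha^2)y_T^2}}{\alpha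 y_T}.$$
   Context: Active Target Defense Differential Game (ATDDG). Three players move in the Euclidean plane with simple motion: a Target $T$ at $(x_T,y_T)$, an Attacker $A$ at $(x_A,y_A)$, and a Defender $D$ at $(x_D,y_D)$. Speeds are constant and normalized so that $A$ and $D$ both have speed $1$ and $T$ has speed $\alpha=V_T/V_A<1$, where $V_T$ and $V_A$ are the speeds of $T$ and $A$ before normalization. The dynamics are $$\dot x_A=\cos\chi,\ \dot y_A=\sin\chi,\quad \dot x_D=\cos\psi,\ \dot y_D=\sin\psi,\quad \dot x_T=\alpha\cos\phi,\ \dot y_T=\alpha\sin\phi,$$ with instantaneous headings $\chi,\phi,\psi\in[-\pi,\pi]$ as controls and given initial positions. $T$ and $D$ form a team choosing $(\phi,\psi)$ against $A$, who chooses $\chi$. The game terminates either when $A$ and $D$ coincide (interception of $A$ by $D$; the Target escapes and the $T/D$ team wins) or when $A$ and $T$ coincide (capture; $A$ wins). The Game of Degree considered is played in the escape region, with terminal condition $(x_A,y_A)=(x_D,y_D)$ at time $t_f$ and cost functional $$J_c=\tfrac12\big[(x_A(t_f)-x_T(t_f))^2+(y_A(t_f)-y_T(t_f))^2\big].$$ The $T/D$ team maximizes this (maximizes the terminal $A$–$T$ separation) and $A$ minimizes it. Optimal headings are state-feedback headings that solve this zero-sum game. Reduced state space: without loss of generality, coordinates are chosen (at the current instant) so that $x_D=-x_A$, $y_A=y_D=0$, $y_T\ge0$; that is, $A=(x_A,0)$ and $D=(-x_A,0)$, and the $y$-axis is the orthogonal bisector of segment $AD$. The reduced state is $(x_A,x_T,y_T)$.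 The part of the state space where the Target can escape is the set of reduced states from which the Target is guaranteed to escape the Attacker (that is, $D$ intercepts $A$ before $A$ captures $T$), provided the Target and Defender team implement their optimal strategies. For $0<\alpha<1$ it is $$R_e=\Big\{(x_A,x_T,y_T): x_A\ge0,\ x_T\ge0,\ y_T\ge0,\ x_A^2+\frac{y_T^2}{1-\alpha^2}-\frac{x_T^2}{\alpha^2}>0\Big\}\cup\{(x_A,x_T,y_T): x_A\ge0,\ x_T\le0\}.$$
   Formalization: The Attacker's heading is proved optimal only against Target/Defender play in which the A–D distance does not close at vanishing speed at interception (otherwise false); y1, y2 are the only nonnegative solutions of the quartic, which can also have negative ones. *)

theory Defs
  imports "HOL-Analysis.Analysis"
begin

text \<open>Points and velocities of the Euclidean plane are complex numbers, so that a player with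
  speed \<open>v\<close> and heading \<open>h\<close> has velocity \<open>v * cis h\<close>. A state of the game is given by the
  positions \<open>A\<close>, \<open>D\<close>, \<open>T\<close> of Attacker, Defender and Target.\<close>

subsection \<open>Reduced states\<close>

text \<open>Target position in the orthonormal frame whose origin is the midpoint of \<open>A\<close> and \<open>D\<close>
  and whose first axis points from \<open>D\<close> to \<open>A\<close>. Its imaginary part may still be negative.\<close>

definition target_frame :: "complex \<Rightarrow> complex \<Rightarrow> complex \<Rightarrow> complex" where
  "target_frame A D T = (T - (A + D) / 2) * cnj (sgn (A - D))"

text \<open>The triple \<open>(x\<^sub>A, x\<^sub>T, y\<^sub>T)\<close>. The absolute value is the reflection in the line \<open>AD\<close> that
  makes \<open>y\<^sub>T \<ge> 0\<close>.\<close>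

definition reduced :: "complex \<Rightarrow> complex \<Rightarrow> complex \<Rightarrow> real \<times> real \<times> real" where
  "reduced A D T =
     (dist A D / 2, Re (target_frame A D T), \<bar>Im (target_frame A D T)\<bar>)"

text \<open>The direction in the original plane of a heading \<open>h\<close> measured in reduced coordinates;
  the reflection, if there was one, is undone.\<close>

definition plane_direction :: "complex \<Rightarrow> complex \<Rightarrow> complex \<Rightarrow> real \<Rightarrow> complex" where
  "plane_direction A D T h =
     sgn (A - D) * (if Im (target_frame A D T) \<ge> 0 then cis h else cnj (cis h))"

text \<open>For \<open>\<alpha> = 0\<close> the first set is empty: the term \<open>x\<^sub>T\<^sup>2 / \<alpha>\<^sup>2\<close> stands for \<open>+\<infinity>\<close> when \<open>x\<^sub>T > 0\<close>
  (division by zero would make it \<open>0\<close>), and states with \<open>x\<^sub>T = 0\<close> are in the second set.\<close>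

definition escape_region :: "real \<Rightarrow> (real \<times> real \<times> real) set" where
  "escape_region \<alpha> =
     {(xA, xT, yT). 0 < \<alpha> \<and> 0 \<le> xA \<and> 0 \<le> xT \<and> 0 \<le> yT \<and>
        xA\<^sup>2 + yT\<^sup>2 / (1 - \<alpha>\<^sup>2) - xT\<^sup>2 / \<alpha>\<^sup>2 > 0} \<union>
     {(xA, xT, yT). 0 \<le> xA \<and> xT \<le> 0}"


subsection \<open>The differential game\<close>

definition active :: "real \<Rightarrow> complex \<Rightarrow> complex \<Rightarrow> complex \<Rightarrow> bool" where
  "active \<alpha> A D T \<longleftrightarrow> A \<noteq> D \<and> reduced A D T \<in> escape_region \<alpha>"

text \<open>Simple motion. The velocity equation may fail at countably many times, which admits
  piecewise continuous headings, also with switching times accumulating at \<open>\<tau>\<close>.\<close>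

definition simple_motion :: "real \<Rightarrow> (real \<Rightarrow> complex) \<Rightarrow> (real \<Rightarrow> real) \<Rightarrow> real \<Rightarrow> bool" where
  "simple_motion v P h \<tau> \<longleftrightarrow>
     continuous_on {0..\<tau>} P \<and> (\<forall>t. h t \<in> {- pi..pi}) \<and>
     (\<exists>S. countable S \<and>
        (\<forall>t \<in> {0<..<\<tau>} - S. (P has_vector_derivative (of_real v * cis (h t))) (at t)))"

text \<open>An evolution of the game up to time \<open>\<tau>\<close> under the heading controls \<open>chi\<close>, \<open>psi\<close>, \<open>phi\<close> of
  \<open>A\<close>, \<open>D\<close>, \<open>T\<close>, taken in the original plane. Before \<open>\<tau>\<close> the state is in the escape region and
  the Attacker has not been intercepted; nothing is assumed about the state at time \<open>\<tau>\<close>.\<close>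

definition evolution ::
  "real \<Rightarrow> (real \<Rightarrow> complex) \<Rightarrow> (real \<Rightarrow> complex) \<Rightarrow> (real \<Rightarrow> complex) \<Rightarrow>
   (real \<Rightarrow> real) \<Rightarrow> (real \<Rightarrow> real) \<Rightarrow> (real \<Rightarrow> real) \<Rightarrow> real \<Rightarrow> bool" where
  "evolution \<alpha> A D T chi psi phi \<tau> \<longleftrightarrow>
     0 < \<tau> \<and> simple_motion 1 A chi \<tau> \<and> simple_motion 1 D psi \<tau> \<and> simple_motion \<alpha> T phi \<tau> \<and>
     (\<forall>t \<in> {0..<\<tau>}. active \<alpha> (A t) (D t) (T t))"

text \<open>The control \<open>h\<close> is generated by the state feedback law \<open>\<kappa>\<close>, which maps reduced states to
  headings in reduced coordinates.\<close>

definition follows ::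
  "(real \<times> real \<times> real \<Rightarrow> real) \<Rightarrow> (real \<Rightarrow> complex) \<Rightarrow> (real \<Rightarrow> complex) \<Rightarrow>
   (real \<Rightarrow> complex) \<Rightarrow> (real \<Rightarrow> real) \<Rightarrow> real \<Rightarrow> bool" where
  "follows \<kappa> A D T h \<tau> \<longleftrightarrow>
     (\<forall>t \<in> {0..<\<tau>}.
        cis (h t) = plane_direction (A t) (D t) (T t) (\<kappa> (reduced (A t) (D t) (T t))))"

text \<open>The cost \<open>J\<^sub>c\<close>; the Target and the Defender maximize it, the Attacker minimizes it.\<close>

definition cost :: "(real \<Rightarrow> complex) \<Rightarrow> (real \<Rightarrow> complex) \<Rightarrow> real \<Rightarrow> real" where
  "cost A T tf = 1/2 * ((Re (A tf) - Re (T tf))\<^sup>2 + (Im (A tf) - Im (T tf))\<^sup>2)"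

text \<open>The distance of \<open>A\<close> and \<open>D\<close> does not close at vanishing speed at the interception time.\<close>

definition nongrazing :: "(real \<Rightarrow> complex) \<Rightarrow> (real \<Rightarrow> complex) \<Rightarrow> real \<Rightarrow> bool" where
  "nongrazing A D tf \<longleftrightarrow> (\<exists>c > 0. \<forall>t \<in> {0..tf}. c * (tf - t) \<le> dist (A t) (D t))"

text \<open>The feedback laws form a saddle point of the game with terminal condition
  \<open>A tf = D tf\<close>, from every initial state in the escape region: (1) when all players use them,
  the play ends in interception with some cost \<open>J\<close>; (2) against the Attacker's law no controls of
  Target and Defender reach a larger cost; (3) against the laws of Target and Defender
  no control of the Attacker reaches a smaller cost; (4) nor can it make the state leave the
  escape region other than by interception.

  In (2) grazing interceptions are excluded. Where \<open>A\<close> is close to \<open>D\<close> and heads almost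
  perpendicularly to \<open>AD\<close>, the Defender can bend its course so that \<open>dist A D\<close> decreases like
  \<open>(tf - t)\<^sup>2\<close>; such a play ends early, with a cost above the one of play (1).\<close>

definition optimal_headings ::
  "real \<Rightarrow> (real \<times> real \<times> real \<Rightarrow> real) \<Rightarrow> (real \<times> real \<times> real \<Rightarrow> real) \<Rightarrow>
   (real \<times> real \<times> real \<Rightarrow> real) \<Rightarrow> bool" where
  "optimal_headings \<alpha> chis phis psis \<longleftrightarrow>
     (\<forall>A0 D0 T0. active \<alpha> A0 D0 T0 \<longrightarrow>
       (\<exists>J.
         (\<exists>A D T chi psi phi tf.
            evolution \<alpha> A D T chi psi phi tf \<and> A 0 = A0 \<and> D 0 = D0 \<and> T 0 = T0 \<and>
            follows chis A D T chi tf \<and> follows psis A D T psi tf \<and> follows phis A D T phi tf \<and>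
            A tf = D tf \<and> nongrazing A D tf \<and> cost A T tf = J) \<and>
         (\<forall>A D T chi psi phi tf.
            evolution \<alpha> A D T chi psi phi tf \<and> A 0 = A0 \<and> D 0 = D0 \<and> T 0 = T0 \<and>
            follows chis A D T chi tf \<and> A tf = D tf \<and> nongrazing A D tf \<longrightarrow>
            cost A T tf \<le> J) \<and>
         (\<forall>A D T chi psi phi tf.
            evolution \<alpha> A D T chi psi phi tf \<and> A 0 = A0 \<and> D 0 = D0 \<and> T 0 = T0 \<and>
            follows psis A D T psi tf \<and> follows phis A D T phi tf \<and> A tf = D tf \<longrightarrow>
            J \<le> cost A T tf) \<and>
         (\<forall>A D T chi psi phi \<tau>.
            evolution \<alpha> A D T chi psi phi \<tau> \<and> A 0 = A0 \<and> D 0 = D0 \<and> T 0 = T0 \<and>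
            follows psis A D T psi \<tau> \<and> follows phis A D T phi \<tau> \<longrightarrow>
            A \<tau> = D \<tau> \<or> active \<alpha> (A \<tau>) (D \<tau>) (T \<tau>))))"


subsection \<open>The quartic and the control laws\<close>

definition quartic :: "real \<Rightarrow> real \<times> real \<times> real \<Rightarrow> real \<Rightarrow> real" where
  "quartic \<alpha> = (\<lambda>(xA, xT, yT) y.
     (1 - \<alpha>\<^sup>2) * y^4 - 2 * (1 - \<alpha>\<^sup>2) * yT * y^3
     + ((1 - \<alpha>\<^sup>2) * yT\<^sup>2 + xA\<^sup>2 - \<alpha>\<^sup>2 * xT\<^sup>2) * y\<^sup>2
     - 2 * xA\<^sup>2 * yT * y + xA\<^sup>2 * yT\<^sup>2)"

text \<open>\<open>control_laws \<alpha> y1 y2 chi phi psi (x\<^sub>A, x\<^sub>T, y\<^sub>T)\<close>: at the given reduced state the laws \<open>chi\<close>, \<open>phi\<close>,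
  \<open>psi\<close> have the stated values for the two solutions \<open>y1\<close>, \<open>y2\<close>. For \<open>x\<^sub>T = 0\<close> the angle \<open>\<theta>\<close> with
  \<open>tan \<theta> = \<surd>(x\<^sub>A\<^sup>2 + (1 - \<alpha>\<^sup>2) y\<^sub>T\<^sup>2) / (\<alpha> y\<^sub>T)\<close> is taken in \<open>[0, \<pi>/2]\<close>, being \<open>\<pi>/2\<close>
  (infinite tangent) when the denominator vanishes.\<close>

definition control_laws ::
  "real \<Rightarrow> (real \<times> real \<times> real \<Rightarrow> real) \<Rightarrow> (real \<times> real \<times> real \<Rightarrow> real) \<Rightarrow>
   (real \<times> real \<times> real \<Rightarrow> real) \<Rightarrow> (real \<times> real \<times> real \<Rightarrow> real) \<Rightarrow>
   (real \<times> real \<times> real \<Rightarrow> real) \<Rightarrow> real \<times> real \<times> real \<Rightarrow> bool" where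
  "control_laws \<alpha> y1 y2 chi phi psi = (\<lambda>(xA, xT, yT).
     let s = (xA, xT, yT);
         y = (if xT \<le> 0 then y1 s else y2 s);
         \<sigma> = (if xT < 0 then 1 else - 1)
     in cos (chi s) = - xA / sqrt (xA\<^sup>2 + y\<^sup>2) \<and> sin (chi s) = y / sqrt (xA\<^sup>2 + y\<^sup>2) \<and>
        cos (psi s) = xA / sqrt (xA\<^sup>2 + y\<^sup>2) \<and> sin (psi s) = y / sqrt (xA\<^sup>2 + y\<^sup>2) \<and>
        (xT \<noteq> 0 \<longrightarrow>
           cos (phi s) = \<sigma> * (xT / sqrt (xT\<^sup>2 + (yT - y)\<^sup>2)) \<and>
           sin (phi s) = \<sigma> * ((yT - y) / sqrt (xT\<^sup>2 + (yT - y)\<^sup>2))) \<and>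
        (xT = 0 \<longrightarrow>
           (\<exists>\<theta> \<in> {0..pi/2}.
              phi s = \<theta> + pi/2 \<and>
              (if \<alpha> * yT = 0 then \<theta> = pi/2
               else tan \<theta> = sqrt (xA\<^sup>2 + (1 - \<alpha>\<^sup>2) * yT\<^sup>2) / (\<alpha> * yT)))))"

end

theory Submission
  imports Defs
begin

text \<open>Parametrize candidate headings by the angle \<open>\<beta>\<close> between \<open>AD\<close> and the course of the Defender. In all of
  the escape region the signed terminal separation under optimal play is the maximum over \<open>\<beta>\<close> of
  \<open>\<alpha> (x\<^sub>A cos \<beta> + y\<^sub>T sin \<beta>) - x\<^sub>T \<surd>(1 - \<alpha>\<^sup>2 sin\<^sup>2 \<beta>)\<close>, whose stationarity condition is the quartic for
  \<open>y = x\<^sub>A tan \<beta>\<close>. Freezing the maximizing \<open>\<beta>\<close> at one instant gives a smooth function of time that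
  touches the value from below, so the sign of its derivative decides monotonicity of the
  value along a play, although the value itself is never differentiated. In the moving frame this
  derivative splits into one term for each player, and the control laws optimize these terms
  separately. The escape region is where the value is positive (nonnegative if \<open>\<alpha> = 0\<close>), so
  monotonicity also keeps the state in it.\<close>

subsection \<open>Monotonicity from supporting functions\<close>

text \<open>A stationary \<beta> is a maximum only while the signed terminal separation
  \<open>\<alpha> * \<tau> + r\<close> is nonnegative. This sign condition also picks out one root
  of the quartic, and it holds throughout the escape region. The two halves of the saddle point end
  differently. The frame along \<open>A - D\<close> has no limit when Attacker and Defender meet,
  and the value need not tend to the distance of \<open>A\<close> and \<open>T\<close>: at distance
  0 the supremum sees only Target headings with negative first component and second component at
  most \<alpha> in absolute value. The value is always below a quantity that does tend to this
  distance, which settles deviations of the Attacker. For deviations of Target and Defender the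
  opposite bound is needed; it is obtained from a quantitative loss in the Defender's term of the
  derivative, which nongrazing plays cannot afford.\<close>

text \<open>After tilting \<open>f\<close> by a small \<epsilon>, consider the last time at which it
  is at or above a level \<open>c\<close>: there the supporting function pushes it above
  \<open>c\<close> again. A countable exceptional set is harmless because \<open>c\<close> can avoid
  its image.\<close>

lemma nondecreasing_if_support_below:
  fixes f :: "real \<Rightarrow> real"
  assumes ab: "a \<le> b" and cont: "continuous_on {a..b} f" and S: "countable S"
    and supp: "\<And>t. t \<in> {a<..<b} - S \<Longrightarrow>
      \<exists>g g'. (g has_real_derivative g') (at t) \<and> g t = f t \<and> (\<forall>s \<in> {a..b}. g s \<le> f s) \<and> 0 \<le> g'"
  shows "f a \<le> f b"
proof (rule ccontr)
  assume "\<not> f a \<le> f b"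
  then have less: "f b < f a" by simp
  with ab have "a < b" by (cases "a = b") auto
  \<comment> \<open>Half the mean rate of descent: the tilted function still descends from
    \<open>a\<close> to \<open>b\<close>, yet its supporting functions have derivative at least
    \<epsilon>.\<close>
  define \<epsilon> where "\<epsilon> = (f a - f b) / (2 * (b - a))"
  have \<epsilon>: "\<epsilon> > 0" using less \<open>a < b\<close> by (simp add: \<epsilon>_def)
  define F where "F t = f t + \<epsilon> * (t - a)" for t
  have contF: "continuous_on {a..b} F" unfolding F_def by (intro continuous_intros cont)
  have "\<epsilon> * (b - a) = (f a - f b) / 2" using \<open>a < b\<close> by (simp add: \<epsilon>_def field_split_simps)
  then have "F b < F a" using less by (simp add: F_def)
  have "uncountable {F b<..<F a}" using \<open>F b < F a\<close> by (simp add: uncountable_open_interval)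
  moreover have "countable (F ` S)" using S by simp
  ultimately have "\<not> {F b<..<F a} \<subseteq> F ` S" using countable_subset by blast
  then obtain c where c: "F b < c" "c < F a" "c \<notin> F ` S"
    unfolding subset_iff by (metis greaterThanLessThan_iff)
  define K where "K = {t \<in> {a..b}. c \<le> F t}"
  have "closed K" unfolding K_def
    by (intro continuous_on_closed_Collect_le continuous_intros contF)
  then have "compact K" unfolding K_def
    by (metis (no_types, lifting) bounded_closed_interval bounded_subset compact_eq_bounded_closed mem_Collect_eq subsetI)
  moreover have "a \<in> K" using c ab by (auto simp: K_def)
  ultimately obtain t where t: "t \<in> K" "\<And>s. s \<in> K \<Longrightarrow> s \<le> t"
    by (metis compact_attains_sup empty_iff)
  have tb: "t < b" "a \<le> t" "c \<le> F t" using t(1) c by (auto simp: K_def order_less_le)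
  have "F t = c"
  proof (rule ccontr)
    assume "F t \<noteq> c"
    then have "\<exists>s\<ge>t. s \<le> b \<and> F s = c" using tb c
      by (intro IVT2') (auto intro: continuous_on_subset[OF contF])
    then obtain s where s: "t \<le> s" "s \<le> b" "F s = c" by blast
    then have "s \<in> K" using tb by (auto simp: K_def)
    then show False using t(2) s \<open>F t \<noteq> c\<close> by fastforce
  qed
  with c tb have "t \<in> {a<..<b} - S" by (cases "a = t") auto
  from supp[OF this] obtain g g' where g: "(g has_real_derivative g') (at t)" "g t = f t"
    "\<And>s. s \<in> {a..b} \<Longrightarrow> g s \<le> f s" "0 \<le> g'" by blast
  have "((\<lambda>s. g s + \<epsilon> * (s - a)) has_real_derivative g' + \<epsilon>) (at t)"
    using g(1) by (auto intro!: derivative_eq_intros)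
  from DERIV_pos_inc_right[OF this] g(4) \<epsilon> obtain d where
    d: "0 < d" "\<And>h. 0 < h \<Longrightarrow> h < d \<Longrightarrow> g t + \<epsilon> * (t - a) < g (t + h) + \<epsilon> * (t + h - a)"
    by auto
  define h where "h = min (d / 2) (b - t)"
  have h: "0 < h" "h < d" "t + h \<le> b" using d tb by (auto simp: h_def)
  have "c < g (t + h) + \<epsilon> * (t + h - a)" using d(2)[OF h(1,2)] g(2) \<open>F t = c\<close> by (simp add: F_def)
  also have "\<dots> \<le> F (t + h)" using g(3)[of "t + h"] h tb by (simp add: F_def)
  finally have "t + h \<in> K" using h tb by (auto simp: K_def)
  then show False using t(2)[of "t + h"] h by simp
qed

text \<open>Time is reversed, not the sign of \<open>f\<close>: a negated \<open>f\<close> would be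
  supported from above, whereas payoffs support the value from below.\<close>

lemma nonincreasing_if_support_below:
  fixes f :: "real \<Rightarrow> real"
  assumes ab: "a \<le> b" and cont: "continuous_on {a..b} f" and S: "countable S"
    and supp: "\<And>t. t \<in> {a<..<b} - S \<Longrightarrow>
      \<exists>g g'. (g has_real_derivative g') (at t) \<and> g t = f t \<and> (\<forall>s \<in> {a..b}. g s \<le> f s) \<and> g' \<le> 0"
  shows "f b \<le> f a"
proof -
  have "f (- (- b)) \<le> f (- (- a))"
  proof (rule nondecreasing_if_support_below[where f = "\<lambda>t. f (- t)" and S = "uminus ` S"])
    show "continuous_on {- b..- a} (\<lambda>t. f (- t))"
      by (rule continuous_on_compose2[OF cont]) (auto intro!: continuous_intros)
  next
    fix t assume "t \<in> {- b<..<- a} - uminus ` S"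
    then have "- t \<in> {a<..<b} - S" by (auto simp: image_iff)
    from supp[OF this] obtain g g' where g: "(g has_real_derivative g') (at (- t))" "g (- t) = f (- t)"
      "\<And>s. s \<in> {a..b} \<Longrightarrow> g s \<le> f s" "g' \<le> 0" by blast
    have "((\<lambda>s. g (- s)) has_real_derivative - g') (at t)"
      using g(1) by (simp add: DERIV_mirror)
    then show "\<exists>g g'. (g has_real_derivative g') (at t) \<and> g t = f (- t)
        \<and> (\<forall>s\<in>{- b..- a}. g s \<le> f (- s)) \<and> 0 \<le> g'"
      using g by (intro exI[of _ "\<lambda>s. g (- s)"] exI[of _ "- g'"]) auto
  qed (use ab S in auto)
  then show ?thesis by simp
qed

subsection \<open>The control laws and the value function\<close>

text \<open>A difference of squares, so that a real root solves one of two equations of lower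
  complexity that differ in the sign of \<open>\<alpha> * xT * y\<close>. All root counting is done
  on these.\<close>

lemma quartic_eq:
  "quartic \<alpha> (xA, xT, yT) y = (xA\<^sup>2 + (1 - \<alpha>\<^sup>2) * y\<^sup>2) * (y - yT)\<^sup>2 - (\<alpha> * xT * y)\<^sup>2"
  unfolding quartic_def by (simp add: power2_eq_square power4_eq_xxxx power3_eq_cube algebra_simps)

definition root_factor :: "real \<Rightarrow> real \<Rightarrow> real \<Rightarrow> real" where
  "root_factor \<alpha> xA y = sqrt (xA\<^sup>2 + (1 - \<alpha>\<^sup>2) * y\<^sup>2)"

text \<open>Ensures that the optimality claim is about a nonempty family of laws. A vector with
  nonzero first component normalizes to a heading; \<open>xA\<close> supplies this component for
  Attacker and Defender, \<open>xT\<close> for the Target.\<close>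

lemma control_laws_at_state_exist:
  assumes "0 \<le> \<alpha>" "\<alpha> < 1" "0 < xA" "0 \<le> yT"
  shows "\<exists>chi phi psi. control_laws \<alpha> y1 y2 (\<lambda>_. chi) (\<lambda>_. phi) (\<lambda>_. psi) (xA, xT, yT)"
proof -
  define y where "y = (if xT \<le> 0 then y1 (xA, xT, yT) else y2 (xA, xT, yT))"
  define \<sigma> :: real where "\<sigma> = (if xT < 0 then 1 else - 1)"
  have heading: "\<exists>h. cos h = a / sqrt (a\<^sup>2 + b\<^sup>2) \<and> sin h = b / sqrt (a\<^sup>2 + b\<^sup>2)" if "a \<noteq> 0" for a b :: real
  proof -
    have "(a / sqrt (a\<^sup>2 + b\<^sup>2))\<^sup>2 + (b / sqrt (a\<^sup>2 + b\<^sup>2))\<^sup>2 = 1"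
      using that by (simp add: power_divide sum_power2_eq_zero_iff flip: add_divide_distrib)
    then show ?thesis by (metis sincos_total_2pi)
  qed
  obtain chi where chi: "cos chi = - xA / sqrt (xA\<^sup>2 + y\<^sup>2)" "sin chi = y / sqrt (xA\<^sup>2 + y\<^sup>2)"
    using heading[of "- xA" y] assms by auto
  obtain psi where psi: "cos psi = xA / sqrt (xA\<^sup>2 + y\<^sup>2)" "sin psi = y / sqrt (xA\<^sup>2 + y\<^sup>2)"
    using heading[of xA y] assms by auto
  have "\<exists>phi. (xT \<noteq> 0 \<longrightarrow> cos phi = \<sigma> * (xT / sqrt (xT\<^sup>2 + (yT - y)\<^sup>2)) \<and>
        sin phi = \<sigma> * ((yT - y) / sqrt (xT\<^sup>2 + (yT - y)\<^sup>2))) \<and>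
      (xT = 0 \<longrightarrow> (\<exists>\<theta> \<in> {0..pi/2}. phi = \<theta> + pi/2 \<and>
        (if \<alpha> * yT = 0 then \<theta> = pi/2
         else tan \<theta> = (sqrt (xA\<^sup>2 + (1 - \<alpha>\<^sup>2) * yT\<^sup>2) / (\<alpha> * yT)))))"
  proof (cases "xT = 0")
    case True
    define \<theta> where "\<theta> = (if \<alpha> * yT = 0 then pi / 2
      else arctan (sqrt (xA\<^sup>2 + (1 - \<alpha>\<^sup>2) * yT\<^sup>2) / (\<alpha> * yT)))"
    have "0 \<le> sqrt (xA\<^sup>2 + (1 - \<alpha>\<^sup>2) * yT\<^sup>2) / (\<alpha> * yT)"
      using assms by (auto simp: abs_square_le_1)
    then have "\<theta> \<in> {0..pi/2}"
      using arctan_ubound by (auto simp: \<theta>_def intro: less_imp_le simp del: arctan_le_zero_iff)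
    then show ?thesis using True
      by (intro exI[of _ "\<theta> + pi/2"]) (auto simp: \<theta>_def tan_arctan intro!: bexI[of _ \<theta>])
  next
    case False
    then show ?thesis
      using heading[of "\<sigma> * xT" "\<sigma> * (yT - y)"] by (auto simp: \<sigma>_def power2_commute[of y])
  qed
  then obtain phi where "(xT \<noteq> 0 \<longrightarrow> cos phi = \<sigma> * (xT / sqrt (xT\<^sup>2 + (yT - y)\<^sup>2)) \<and>
        sin phi = \<sigma> * ((yT - y) / sqrt (xT\<^sup>2 + (yT - y)\<^sup>2))) \<and>
      (xT = 0 \<longrightarrow> (\<exists>\<theta> \<in> {0..pi/2}. phi = \<theta> + pi/2 \<and>
        (if \<alpha> * yT = 0 then \<theta> = pi/2
         else tan \<theta> = (sqrt (xA\<^sup>2 + (1 - \<alpha>\<^sup>2) * yT\<^sup>2) / (\<alpha> * yT)))))" by blast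
  with chi psi have "control_laws \<alpha> y1 y2 (\<lambda>_. chi) (\<lambda>_. phi) (\<lambda>_. psi) (xA, xT, yT)"
    unfolding control_laws_def prod.case Let_def y_def[symmetric] \<sigma>_def[symmetric] by blast
  then show ?thesis by blast
qed

lemma control_laws_exist:
  assumes "0 \<le> \<alpha>" "\<alpha> < 1"
  shows "\<exists>chi phi psi. \<forall>xA xT yT. 0 < xA \<and> 0 \<le> yT \<longrightarrow>
    control_laws \<alpha> y1 y2 chi phi psi (xA, xT, yT)"
proof -
  have "\<forall>s. \<exists>h. 0 < fst s \<and> 0 \<le> snd (snd s) \<longrightarrow>
      control_laws \<alpha> y1 y2 (\<lambda>_. fst h) (\<lambda>_. fst (snd h)) (\<lambda>_. snd (snd h)) s"
    using control_laws_at_state_exist[OF assms, of _ _ y1 y2] by fastforce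
  then obtain h where h: "0 < fst s \<and> 0 \<le> snd (snd s) \<longrightarrow>
      control_laws \<alpha> y1 y2 (\<lambda>_. fst (h s)) (\<lambda>_. fst (snd (h s))) (\<lambda>_. snd (snd (h s))) s" for s
    by metis
  have "control_laws \<alpha> y1 y2 (\<lambda>s. fst (h s)) (\<lambda>s. fst (snd (h s))) (\<lambda>s. snd (snd (h s))) (xA, xT, yT)"
    if "0 < xA" "0 \<le> yT" for xA xT yT
    using h[of "(xA, xT, yT)"] that unfolding control_laws_def by simp
  then show ?thesis by blast
qed

text \<open>Lagrange's identity. The weight will be \<open>1 - \<alpha>\<^sup>2\<close>, under which
  \<open>(cos \<beta>, sin \<beta>)\<close> has norm
  \<open>lateral \<alpha> \<beta>\<close>.\<close>

lemma weighted_Cauchy_Schwarz: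
  fixes k :: real
  assumes "0 \<le> k"
  shows "(a * c + k * (b * d))\<^sup>2 \<le> (a\<^sup>2 + k * b\<^sup>2) * (c\<^sup>2 + k * d\<^sup>2)"
proof -
  have "(a\<^sup>2 + k * b\<^sup>2) * (c\<^sup>2 + k * d\<^sup>2) - (a * c + k * (b * d))\<^sup>2 = k * (a * d - b * c)\<^sup>2"
    by (simp add: power2_eq_square algebra_simps)
  moreover have "0 \<le> k * (a * d - b * c)\<^sup>2" using assms by simp
  ultimately show ?thesis by linarith
qed

definition lateral :: "real \<Rightarrow> real \<Rightarrow> real" where
  "lateral \<alpha> \<beta> = sqrt (1 - (\<alpha> * sin \<beta>)\<^sup>2)"

text \<open>Snell's law with index \<alpha>: the component along the bisector of \<open>AD\<close>
  is \<alpha> times that of the Defender heading \<open>cis \<beta>\<close>. The minus sign points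
  towards the Defender's side.\<close>

definition retreat :: "real \<Rightarrow> real \<Rightarrow> complex" where
  "retreat \<alpha> \<beta> = Complex (- lateral \<alpha> \<beta>) (\<alpha> * sin \<beta>)"

text \<open>Here \<open>d\<close> is the distance of \<open>A\<close> and \<open>D\<close>, and \<open>z\<close> the Target position \<open>x\<^sub>T + i y\<^sub>T\<close> in the moving frame
  (before reflection, so \<open>\<beta>\<close> may be negative).\<close>

definition payoff :: "real \<Rightarrow> real \<Rightarrow> real \<Rightarrow> complex \<Rightarrow> real" where
  "payoff \<alpha> \<beta> d z = \<alpha> * cos \<beta> * d / 2 + Re (z * cnj (retreat \<alpha> \<beta>))"

text \<open>Attacker and Defender are to meet after time \<open>\<tau>\<close> at \<open>I = i \<tau> sin \<beta>\<close>, from which the Target has the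
  signed distance \<open>r\<close> in the direction of its heading: \<open>r > 0\<close> when it flees from \<open>I\<close>, \<open>r < 0\<close> when
  it still has to pass through \<open>I\<close>.\<close>

definition aim :: "real \<Rightarrow> real \<Rightarrow> real \<Rightarrow> real \<Rightarrow> real \<Rightarrow> complex \<Rightarrow> bool" where
  "aim \<alpha> \<beta> \<tau> r d z \<longleftrightarrow> 0 < cos \<beta> \<and> 0 < \<tau> \<and> d = 2 * \<tau> * cos \<beta> \<and>
     z = Complex 0 (\<tau> * sin \<beta>) + of_real r * retreat \<alpha> \<beta> \<and> 0 \<le> \<alpha> * \<tau> + r"

text \<open>A supremum over all real \<beta> makes sense also at states not yet known to be in the
  escape region, such as the final state of a play, whose membership is decided by this
  value.\<close>

definition game_value :: "real \<Rightarrow> real \<Rightarrow> complex \<Rightarrow> real" where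
  "game_value \<alpha> d z = (SUP \<beta>. payoff \<alpha> \<beta> d z)"

lemma lateral_uminus: "lateral \<alpha> (- \<beta>) = lateral \<alpha> \<beta>"
  by (simp add: lateral_def)

lemma retreat_uminus: "retreat \<alpha> (- \<beta>) = cnj (retreat \<alpha> \<beta>)"
  by (simp add: retreat_def lateral_uminus complex_eq_iff)

lemma aim_reflect: "aim \<alpha> \<beta> \<tau> r d z \<Longrightarrow> aim \<alpha> (- \<beta>) \<tau> r d (cnj z)"
  by (auto simp: aim_def retreat_uminus complex_eq_iff)

lemma payoff_aim:
  assumes "aim \<alpha> \<beta> \<tau> r d z"
  shows "payoff \<alpha> \<beta>' d z = \<alpha> * \<tau> * cos (\<beta> - \<beta>') + r * Re (retreat \<alpha> \<beta> * cnj (retreat \<alpha> \<beta>'))"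
  using assms by (simp add: aim_def payoff_def retreat_def cos_diff algebra_simps)

subsection \<open>Kinematics\<close>

lemma sgn_times_cnj: "A \<noteq> D \<Longrightarrow> sgn (A - D) * w * cnj (sgn (A - D)) = w" for A D w :: complex
  by (simp add: norm_sgn mult.commute[of _ w] mult.assoc complex_norm_square[symmetric])

lemma dist_target_frame:
  assumes "A \<noteq> D"
  shows "dist A T = cmod (target_frame A D T - of_real (dist A D / 2))"
proof -
  define n where "n = sgn (A - D)"
  have n: "cmod n = 1" "n * cnj n = 1"
    using assms by (auto simp: n_def norm_sgn complex_norm_square[symmetric])
  have "A - D = of_real (dist A D) * n" using assms by (simp add: n_def sgn_eq dist_norm)
  then have "of_real (dist A D / 2) * (n * cnj n) = (A - D) / 2 * cnj n" by simp
  then have "target_frame A D T - of_real (dist A D / 2) = (T - (A + D) / 2 - (A - D) / 2) * cnj n"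
    unfolding n(2) target_frame_def n_def[symmetric] left_diff_distrib by simp
  also have "T - (A + D) / 2 - (A - D) / 2 = T - A" by (simp add: field_simps)
  finally have "target_frame A D T - of_real (dist A D / 2) = (T - A) * cnj n" .
  then show ?thesis by (simp add: norm_mult n dist_norm norm_minus_commute)
qed

lemma has_real_derivative_dist:
  fixes A D :: "real \<Rightarrow> complex"
  assumes "(A has_vector_derivative A') (at t)" "(D has_vector_derivative D') (at t)" "A t \<noteq> D t"
  shows "((\<lambda>t. dist (A t) (D t)) has_real_derivative Re ((A' - D') * cnj (sgn (A t - D t)))) (at t)"
proof -
  have P: "((\<lambda>t. A t - D t) has_vector_derivative A' - D') (at t)"
    by (intro derivative_intros assms)
  have "((\<lambda>t. norm (A t - D t)) has_derivative (\<lambda>h. (h *\<^sub>R (A' - D')) \<bullet> sgn (A t - D t))) (at t)"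
    using has_derivative_compose[OF P[unfolded has_vector_derivative_def] has_derivative_norm] assms(3) by simp
  moreover have "(\<lambda>h. (h *\<^sub>R x) \<bullet> y) = (*) (Re (x * cnj y))" for x y :: complex
    by (simp add: fun_eq_iff inner_complex_def algebra_simps)
  ultimately show ?thesis by (simp only: has_field_derivative_def dist_norm)
qed

text \<open>The frame position is \<open>Q * cnj P / N\<close> with \<open>N\<close> the norm of
  \<open>P\<close>, so the quotient rule applies. The last summand is the rotation of the frame,
  whose angular velocity is \<open>Im p / dist (A t) (D t)\<close>.\<close>

lemma has_real_derivative_payoff:
  fixes A D T :: "real \<Rightarrow> complex" and \<alpha> \<beta> :: real
  assumes A: "(A has_vector_derivative A') (at t)" and D: "(D has_vector_derivative D') (at t)"
    and T: "(T has_vector_derivative T') (at t)" and ne: "A t \<noteq> D t"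
  defines "n \<equiv> sgn (A t - D t)" and "e \<equiv> retreat \<alpha> \<beta>"
  defines "p \<equiv> (A' - D') * cnj n"
  shows "((\<lambda>t. payoff \<alpha> \<beta> (dist (A t) (D t)) (target_frame (A t) (D t) (T t))) has_real_derivative
    \<alpha> * cos \<beta> * Re p / 2 + Re ((T' - (A' + D') / 2) * cnj n * cnj e)
      + Im p * Im (target_frame (A t) (D t) (T t) * cnj e) / dist (A t) (D t)) (at t)"
proof -
  define P where "P t = A t - D t" for t
  define Q where "Q t = T t - (A t + D t) / 2" for t
  define N where "N t = dist (A t) (D t)" for t
  define z where "z = target_frame (A t) (D t) (T t)"
  have N: "0 < N t" using ne by (simp add: N_def)
  have n: "cmod n = 1" "n * cnj n = 1"
    using ne by (auto simp: n_def norm_sgn complex_norm_square[symmetric])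
  have P': "(P has_vector_derivative A' - D') (at t)"
    unfolding P_def by (intro derivative_intros A D)
  have Q': "(Q has_vector_derivative T' - (A' + D') / 2) (at t)"
    unfolding Q_def by (intro derivative_intros A D T)
  have N': "(N has_real_derivative Re p) (at t)"
    unfolding N_def p_def n_def using has_real_derivative_dist A D ne .
  have "payoff \<alpha> \<beta> (dist (A s) (D s)) (target_frame (A s) (D s) (T s))
      = \<alpha> * cos \<beta> * N s / 2 + Re (Q s * cnj (P s) * cnj e) / N s" for s
  proof -
    have "target_frame (A s) (D s) (T s) * cnj e = (Q s * cnj (P s) * cnj e) / of_real (N s)"
      by (simp add: target_frame_def P_def Q_def N_def sgn_eq dist_norm)
    then show ?thesis unfolding payoff_def e_def[symmetric] by (simp add: N_def)
  qed
  moreover have F: "((\<lambda>s. Re (Q s * cnj (P s) * cnj e)) has_real_derivative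
      Re (((T' - (A' + D') / 2) * cnj (P t) + Q t * cnj (A' - D')) * cnj e)) (at t)"
    unfolding has_real_derivative_iff_has_vector_derivative
    by (rule derivative_eq_intros bounded_linear.has_vector_derivative[OF bounded_linear_Re] P' Q'
       bounded_linear.has_vector_derivative[OF bounded_linear_cnj] refl | simp add: algebra_simps)+
  ultimately have "((\<lambda>t. payoff \<alpha> \<beta> (dist (A t) (D t)) (target_frame (A t) (D t) (T t))) has_real_derivative
      \<alpha> * cos \<beta> * Re p / 2 + (Re (((T' - (A' + D') / 2) * cnj (P t) + Q t * cnj (A' - D')) * cnj e) * N t
        - Re (Q t * cnj (P t) * cnj e) * Re p) / (N t * N t)) (at t)"
    using DERIV_add[OF DERIV_cdivide[OF DERIV_cmult[OF N', of "\<alpha> * cos \<beta>"], of 2] DERIV_divide[OF F N']] N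
    by simp
  moreover have PQ: "P t = of_real (N t) * n" "A' - D' = p * n" "Q t = z * n"
  proof -
    show "P t = of_real (N t) * n" using ne by (simp add: P_def N_def n_def dist_norm sgn_eq)
    have "p * n = (A' - D') * (n * cnj n)" by (simp only: p_def mult_ac)
    then show "A' - D' = p * n" using n(2) by simp
    have "z * n = Q t * (n * cnj n)" by (simp only: z_def target_frame_def Q_def n_def mult_ac)
    then show "Q t = z * n" using n(2) by simp
  qed
  have "((T' - (A' + D') / 2) * cnj (P t) + Q t * cnj (A' - D')) * cnj e
      = of_real (N t) * ((T' - (A' + D') / 2) * cnj n * cnj e) + (z * cnj e) * cnj p * (n * cnj n)"
    unfolding PQ by (simp add: algebra_simps)
  then have 1: "Re (((T' - (A' + D') / 2) * cnj (P t) + Q t * cnj (A' - D')) * cnj e)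
     = N t * Re ((T' - (A' + D') / 2) * cnj n * cnj e) + Re (z * cnj e) * Re p + Im (z * cnj e) * Im p"
    unfolding n(2) by simp
  have "Q t * cnj (P t) * cnj e = of_real (N t) * (z * cnj e) * (n * cnj n)"
    unfolding PQ by (simp add: algebra_simps)
  then have Q_frame: "Q t * cnj (P t) * cnj e = of_real (N t) * (z * cnj e)" unfolding n(2) mult_1_right .
  have 2: "Re (Q t * cnj (P t) * cnj e) = N t * Re (z * cnj e)"
    unfolding Q_frame by (simp only: Re_complex_of_real Im_complex_of_real times_complex.sel mult_zero_left diff_zero)
  have "(Re (((T' - (A' + D') / 2) * cnj (P t) + Q t * cnj (A' - D')) * cnj e) * N t
        - Re (Q t * cnj (P t) * cnj e) * Re p) / (N t * N t)
      = Re ((T' - (A' + D') / 2) * cnj n * cnj e) + Im p * Im (z * cnj e) / N t"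
    unfolding 1 2 using N by (simp add: field_simps)
  ultimately show ?thesis unfolding z_def N_def by (simp only: add.assoc)
qed

section \<open>Contribution of each player to the rate of a frozen payoff\<close>

definition attacker_rate :: "real \<Rightarrow> real \<Rightarrow> real" where
  "attacker_rate \<alpha> \<beta> = (lateral \<alpha> \<beta> + \<alpha> * cos \<beta>) / (2 * cos \<beta>)"

definition defender_rate :: "real \<Rightarrow> real \<Rightarrow> real" where
  "defender_rate \<alpha> \<beta> = (lateral \<alpha> \<beta> - \<alpha> * cos \<beta>) / (2 * cos \<beta>)"

text \<open>When all three laws are used, the terms of the rate are \<alpha>,
  \<open>- attacker_rate \<alpha> \<beta>\<close> and \<open>defender_rate \<alpha> \<beta>\<close>.
  They cancel, so optimal play keeps the value constant.\<close>

lemma rates_balance: "0 < cos \<beta> \<Longrightarrow> attacker_rate \<alpha> \<beta> = \<alpha> + defender_rate \<alpha> \<beta>"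
  by (simp add: attacker_rate_def defender_rate_def field_simps)

text \<open>A Defender with velocity \<open>d\<close> that deviates by \<open>\<eta>\<close> from its optimal course closes the distance \<open>N\<close> faster
  at a rate linear in \<open>\<eta>\<close>, but loses value at a rate quadratic in \<open>\<eta>\<close> and inversely proportional to \<open>N\<close>.
  The estimate combines both by \<open>\<eta>\<^sup>2 \<ge> 2 c \<eta> - c\<^sup>2\<close>.\<close>

lemma bending_rate_bound:
  assumes "0 < cos \<beta>" "N = 2 * \<rho> * cos \<beta>" "0 < \<tau>0" "\<tau>0 \<le> \<rho>" "0 \<le> k" "0 < c" "0 < h" "c * h \<le> N"
    and d: "cmod d = 1"
  shows "- (k / cos \<beta>) * (1 - Re (d * cnj (cis \<beta>)))
    \<le> 2 * c * (k * \<tau>0) * (- cos \<beta> - Re d) / N + 2 * c * k + c * (k * \<tau>0) / h"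
proof -
  define K where "K = k * \<tau>0"
  \<comment> \<open>The chord replaces the angle of deviation: it bounds \<open>Re d\<close>
    directly, and its square is twice the Defender's loss.\<close>
  define \<eta> where "\<eta> = cmod (d - cis \<beta>)"
  have K: "0 \<le> K" using assms by (simp add: K_def)
  have N: "0 < N" using assms by simp
  have \<eta>_sq: "\<eta>\<^sup>2 = 2 * (1 - Re (d * cnj (cis \<beta>)))"
  proof -
    have "(Re d)\<^sup>2 + (Im d)\<^sup>2 = 1" using d by (simp add: cmod_def)
    then show ?thesis using sin_cos_squared_add[of \<beta>] unfolding \<eta>_def cmod_power2
      by (simp add: power2_diff algebra_simps)
  qed
  have Re_d: "Re d \<le> cos \<beta> + \<eta>" using complex_Re_le_cmod[of "d - cis \<beta>"] by (simp add: \<eta>_def)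
  have "\<tau>0 * (2 * cos \<beta>) \<le> N" using assms by simp
  then have "(2 * c * k) * (\<tau>0 * (2 * cos \<beta>)) \<le> (2 * c * k) * N"
    using assms by (intro mult_left_mono) auto
  moreover have "(2 * c * K) * (- 2 * cos \<beta> - \<eta>) \<le> (2 * c * K) * (- cos \<beta> - Re d)"
    using Re_d K assms by (intro mult_left_mono) auto
  ultimately have 1: "- (2 * c * k) * N - 2 * c * K * \<eta> \<le> 2 * c * K * (- cos \<beta> - Re d)"
    unfolding K_def by (simp add: algebra_simps)
  \<comment> \<open>Here nongrazing enters: it turns the constant left over from completing the
    square into a multiple of \<open>N / h\<close>, which after division by \<open>N\<close> is
    integrable as a logarithm of the remaining time \<open>h\<close>.\<close>
  have "c \<le> N / h" using assms by (simp add: field_simps)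
  then have "c * K * c \<le> c * K * (N / h)" using K assms by (intro mult_left_mono) auto
  then have 2: "c\<^sup>2 * K \<le> c * K / h * N" by (simp add: power2_eq_square mult_ac)
  have "0 \<le> K * (\<eta> - c)\<^sup>2" using K by simp
  then have 3: "- K * \<eta>\<^sup>2 \<le> - 2 * c * K * \<eta> + c\<^sup>2 * K" by (simp add: power2_diff algebra_simps)
  have "K * \<eta>\<^sup>2 \<le> k * \<rho> * \<eta>\<^sup>2" unfolding K_def using assms by (intro mult_right_mono mult_left_mono) auto
  moreover have "- (k / cos \<beta>) * (1 - Re (d * cnj (cis \<beta>))) * N = - (k * \<rho> * \<eta>\<^sup>2)"
    unfolding \<eta>_sq using assms(1,2) by (simp add: field_simps)
  ultimately have "- (k / cos \<beta>) * (1 - Re (d * cnj (cis \<beta>))) * N \<le> - K * \<eta>\<^sup>2" by simp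
  also note 3
  also have "- 2 * c * K * \<eta> + c\<^sup>2 * K \<le> 2 * c * K * (- cos \<beta> - Re d) + 2 * c * k * N + c * K / h * N"
    using 1 2 by simp
  also have "\<dots> = (2 * c * K * (- cos \<beta> - Re d) / N + 2 * c * k + c * K / h) * N"
    using N by (simp add: distrib_right)
  finally show ?thesis using N unfolding K_def by (simp only: mult_le_cancel_right_pos)
qed

section \<open>Control laws as directions in the plane\<close>

text \<open>The interface between algebra and game: roots, sign cases and the reflection are gone,
  and only the angle \<beta> of an arbitrary \<open>aim\<close> is left.\<close>

definition optimal_laws ::
  "real \<Rightarrow> (real \<times> real \<times> real \<Rightarrow> real) \<Rightarrow> (real \<times> real \<times> real \<Rightarrow> real) \<Rightarrow> (real \<times> real \<times> real \<Rightarrow> real) \<Rightarrow> bool"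
where
  "optimal_laws \<alpha> chi phi psi \<longleftrightarrow> (\<forall>A D T \<beta> \<tau> r. active \<alpha> A D T \<longrightarrow>
     aim \<alpha> \<beta> \<tau> r (dist A D) (target_frame A D T) \<longrightarrow>
     plane_direction A D T (chi (reduced A D T)) = sgn (A - D) * Complex (- cos \<beta>) (sin \<beta>) \<and>
     plane_direction A D T (psi (reduced A D T)) = sgn (A - D) * cis \<beta> \<and>
     plane_direction A D T (phi (reduced A D T)) = sgn (A - D) * retreat \<alpha> \<beta>)"

lemma optimal_lawsD:
  assumes "optimal_laws \<alpha> chi phi psi" "active \<alpha> A D T"
    "aim \<alpha> \<beta> \<tau> r (dist A D) (target_frame A D T)"
  shows "plane_direction A D T (chi (reduced A D T)) = sgn (A - D) * Complex (- cos \<beta>) (sin \<beta>)"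
    "plane_direction A D T (psi (reduced A D T)) = sgn (A - D) * cis \<beta>"
    "plane_direction A D T (phi (reduced A D T)) = sgn (A - D) * retreat \<alpha> \<beta>"
  using assms unfolding optimal_laws_def by blast+

abbreviation play_value :: "real \<Rightarrow> (real \<Rightarrow> complex) \<Rightarrow> (real \<Rightarrow> complex) \<Rightarrow> (real \<Rightarrow> complex) \<Rightarrow> real \<Rightarrow> real" where
  "play_value \<alpha> A D T t \<equiv> game_value \<alpha> (dist (A t) (D t)) (target_frame (A t) (D t) (T t))"

lemma evolution_continuous:
  assumes "evolution \<alpha> A D T chi psi phi \<tau>"
  shows "continuous_on {0..\<tau>} A" "continuous_on {0..\<tau>} D" "continuous_on {0..\<tau>} T"
  using assms by (auto simp: evolution_def simple_motion_def)

lemma evolution_derivatives: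
  assumes "evolution \<alpha> A D T chi psi phi \<tau>"
  obtains S where "countable S"
    "\<And>t. t \<in> {0<..<\<tau>} - S \<Longrightarrow> (A has_vector_derivative cis (chi t)) (at t)"
    "\<And>t. t \<in> {0<..<\<tau>} - S \<Longrightarrow> (D has_vector_derivative cis (psi t)) (at t)"
    "\<And>t. t \<in> {0<..<\<tau>} - S \<Longrightarrow> (T has_vector_derivative of_real \<alpha> * cis (phi t)) (at t)"
proof -
  obtain S1 S2 S3 where "countable S1" "countable S2" "countable S3"
    "\<And>t. t \<in> {0<..<\<tau>} - S1 \<Longrightarrow> (A has_vector_derivative cis (chi t)) (at t)"
    "\<And>t. t \<in> {0<..<\<tau>} - S2 \<Longrightarrow> (D has_vector_derivative cis (psi t)) (at t)"
    "\<And>t. t \<in> {0<..<\<tau>} - S3 \<Longrightarrow> (T has_vector_derivative of_real \<alpha> * cis (phi t)) (at t)"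
    using assms unfolding evolution_def simple_motion_def by auto
  then show ?thesis by (intro that[of "S1 \<union> S2 \<union> S3"]) auto
qed

lemma cost_eq_dist: "cost A T tf = (dist (A tf) (T tf))\<^sup>2 / 2"
  by (simp add: cost_def dist_norm cmod_power2)

lemma heading_exists:
  assumes "cmod w = 1"
  obtains h where "h \<in> {- pi..pi}" "cis h = w"
proof (rule that[of "Arg w"])
  show "Arg w \<in> {- pi..pi}" using Arg_bounded[of w] by (simp add: less_imp_le)
  have "w \<noteq> 0" using assms by auto
  then show "cis (Arg w) = w" using cis_Arg[of w] assms by (simp add: sgn_eq)
qed

context
  fixes \<alpha> :: real
  assumes \<alpha>: "0 \<le> \<alpha>" "\<alpha> < 1"
begin

subsection \<open>Roots of the quartic\<close>

lemma speed_ratio_sq_less_1: "\<alpha>\<^sup>2 < 1"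
  using \<alpha> by (simp add: abs_square_less_1)

lemma root_factor_pos: "0 < xA \<Longrightarrow> 0 < root_factor \<alpha> xA y"
  unfolding root_factor_def using speed_ratio_sq_less_1 by (simp add: add_pos_nonneg)

lemma root_factor_mono: "0 < xA \<Longrightarrow> 0 \<le> y \<Longrightarrow> y < y' \<Longrightarrow> root_factor \<alpha> xA y < root_factor \<alpha> xA y'"
  unfolding root_factor_def using speed_ratio_sq_less_1 by (simp add: power_strict_mono)

lemma quartic_zero_iff:
  "quartic \<alpha> (xA, xT, yT) y = 0 \<longleftrightarrow> \<bar>y - yT\<bar> * root_factor \<alpha> xA y = \<alpha> * \<bar>xT\<bar> * \<bar>y\<bar>"
proof -
  have "0 \<le> xA\<^sup>2 + (1 - \<alpha>\<^sup>2) * y\<^sup>2" using speed_ratio_sq_less_1 by simp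
  then have "(xA\<^sup>2 + (1 - \<alpha>\<^sup>2) * y\<^sup>2) * (y - yT)\<^sup>2 = (\<bar>y - yT\<bar> * root_factor \<alpha> xA y)\<^sup>2"
    by (simp add: root_factor_def power_mult_distrib)
  moreover have "(\<alpha> * xT * y)\<^sup>2 = (\<alpha> * \<bar>xT\<bar> * \<bar>y\<bar>)\<^sup>2" by (simp add: power_mult_distrib)
  ultimately have "quartic \<alpha> (xA, xT, yT) y = 0 \<longleftrightarrow>
    (\<bar>y - yT\<bar> * root_factor \<alpha> xA y)\<^sup>2 = (\<alpha> * \<bar>xT\<bar> * \<bar>y\<bar>)\<^sup>2"
    by (simp add: quartic_eq)
  also have "\<dots> \<longleftrightarrow> \<bar>y - yT\<bar> * root_factor \<alpha> xA y = \<alpha> * \<bar>xT\<bar> * \<bar>y\<bar>"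
    using \<alpha> \<open>0 \<le> xA\<^sup>2 + _\<close> by (intro power2_eq_iff_nonneg) (auto simp: root_factor_def)
  finally show ?thesis .
qed

lemma continuous_on_root_factor: "continuous_on X (root_factor \<alpha> xA)"
  unfolding root_factor_def by (intro continuous_intros)

lemma ratio_root_factor_mono:
  assumes "0 < xA" "0 \<le> u" "u < v"
  shows "u / root_factor \<alpha> xA u \<le> v / root_factor \<alpha> xA v"
proof -
  have "u\<^sup>2 * (xA\<^sup>2 + (1 - \<alpha>\<^sup>2) * v\<^sup>2) \<le> v\<^sup>2 * (xA\<^sup>2 + (1 - \<alpha>\<^sup>2) * u\<^sup>2)"
    using mult_right_mono[of "u\<^sup>2" "v\<^sup>2" "xA\<^sup>2"] assms by (simp add: algebra_simps)
  then have "sqrt (u\<^sup>2 * (xA\<^sup>2 + (1 - \<alpha>\<^sup>2) * v\<^sup>2)) \<le> sqrt (v\<^sup>2 * (xA\<^sup>2 + (1 - \<alpha>\<^sup>2) * u\<^sup>2))"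
    by simp
  then have "u * root_factor \<alpha> xA v \<le> v * root_factor \<alpha> xA u"
    using assms by (simp add: real_sqrt_mult root_factor_def)
  then show ?thesis using assms root_factor_pos[of xA] by (simp add: divide_simps mult.commute)
qed

text \<open>In the form \<open>yT - y = g * (y / root_factor \<alpha> xA y)\<close> the left side
  strictly decreases in \<open>y\<close> while the right side does not decrease.\<close>

lemma lower_root_unique:
  assumes "0 < xA" "0 \<le> g" "0 \<le> y" "0 \<le> y'"
    and "(yT - y) * root_factor \<alpha> xA y = g * y" "(yT - y') * root_factor \<alpha> xA y' = g * y'"
  shows "y = y'"
proof -
  have "False" if "0 \<le> u" "u < v" "(yT - u) * root_factor \<alpha> xA u = g * u"
      "(yT - v) * root_factor \<alpha> xA v = g * v" for u v
  proof -
    let ?S = "root_factor \<alpha> xA"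
    have S: "0 < ?S u" "?S u < ?S v" using that assms root_factor_pos root_factor_mono by auto
    have "u / ?S u \<le> v / ?S v" using that assms by (simp add: ratio_root_factor_mono)
    moreover have "yT - u = g * (u / ?S u)" "yT - v = g * (v / ?S v)"
      using that S by (auto simp: field_simps)
    ultimately have "yT - u \<le> yT - v" using \<open>0 \<le> g\<close> by (metis mult_left_mono)
    then show False using that by simp
  qed
  then show ?thesis using assms by (metis linorder_neqE_linordered_idom)
qed

text \<open>Division by \<open>y * root_factor \<alpha> xA y\<close> gives
  \<open>1 = yT / y + g / root_factor \<alpha> xA y\<close>, whose right side strictly decreases for
  positive \<open>y\<close>.\<close>

lemma upper_root_unique:
  assumes "0 < xA" "0 \<le> g" "0 \<le> yT" "0 < y" "0 < y'" "g > 0 \<or> yT > 0"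
    and "(y - yT) * root_factor \<alpha> xA y = g * y" "(y' - yT) * root_factor \<alpha> xA y' = g * y'"
  shows "y = y'"
proof -
  have "False" if "0 < u" "u < v" "(u - yT) * root_factor \<alpha> xA u = g * u"
      "(v - yT) * root_factor \<alpha> xA v = g * v" for u v
  proof -
    let ?S = "root_factor \<alpha> xA"
    have S: "0 < ?S u" "?S u < ?S v" using that assms root_factor_pos root_factor_mono by auto
    have "1 = yT / u + g / ?S u" "1 = yT / v + g / ?S v"
      using that S by (auto simp: field_simps)
    moreover have "yT / v \<le> yT / u" "g / ?S v \<le> g / ?S u"
      using that S assms by (auto intro!: divide_left_mono mult_pos_pos)
    moreover have "yT / v < yT / u \<or> g / ?S v < g / ?S u"
      using that S assms by (auto intro!: divide_strict_left_mono mult_pos_pos)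
    ultimately show False by linarith
  qed
  then show ?thesis using assms by (metis linorder_neqE_linordered_idom)
qed

lemma lower_root_exists:
  assumes "0 < xA" "0 \<le> g" "0 \<le> yT"
  shows "\<exists>y. 0 \<le> y \<and> y \<le> yT \<and> (yT - y) * root_factor \<alpha> xA y = g * y"
proof -
  have "\<exists>y\<ge>0. y \<le> yT \<and> (yT - y) * root_factor \<alpha> xA y - g * y = 0"
    using assms root_factor_pos[of xA 0]
    by (intro IVT2' continuous_intros continuous_on_root_factor) auto
  then show ?thesis by auto
qed

lemma upper_root_exists:
  assumes "0 < xA" "0 \<le> g" "0 \<le> yT"
  shows "\<exists>y. yT \<le> y \<and> (y - yT) * root_factor \<alpha> xA y = g * y"
proof -
  \<comment> \<open>The solution of the equation with \<open>root_factor\<close> replaced by its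
    lower bound \<open>sqrt (1 - \<alpha>\<^sup>2) * y\<close>; hence at \<open>b\<close> the left
    side already dominates.\<close>
  define b where "b = yT + g / sqrt (1 - \<alpha>\<^sup>2)"
  have q: "0 < sqrt (1 - \<alpha>\<^sup>2)" using speed_ratio_sq_less_1 by simp
  have b: "yT \<le> b" using q assms by (simp add: b_def)
  have "sqrt (1 - \<alpha>\<^sup>2) * b = sqrt ((1 - \<alpha>\<^sup>2) * b\<^sup>2)" using b assms by (simp add: real_sqrt_mult)
  also have "\<dots> \<le> root_factor \<alpha> xA b" by (simp add: root_factor_def)
  finally have "(b - yT) * (sqrt (1 - \<alpha>\<^sup>2) * b) \<le> (b - yT) * root_factor \<alpha> xA b"
    using b by (intro mult_left_mono) auto
  moreover have "(b - yT) * (sqrt (1 - \<alpha>\<^sup>2) * b) = g * b" using q by (simp add: b_def)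
  ultimately have "\<exists>y\<ge>yT. y \<le> b \<and> (y - yT) * root_factor \<alpha> xA y - g * y = 0"
    using assms b by (intro IVT' continuous_intros continuous_on_root_factor) auto
  then show ?thesis by auto
qed

text \<open>On nonnegative \<open>y\<close> the quartic splits into the equations with
  \<open>yT - y\<close> and with \<open>y - yT\<close>, each contributing one of the roots. The
  roots may coincide, for instance at \<open>xT = 0\<close>.\<close>

lemma quartic_roots:
  assumes xA: "0 < xA" and yT: "0 \<le> yT"
  shows "\<exists>y1 y2. {y. 0 \<le> y \<and> quartic \<alpha> (xA, xT, yT) y = 0} = {y1, y2} \<and> y1 \<le> yT \<and> yT \<le> y2"
proof -
  define g where "g = \<alpha> * \<bar>xT\<bar>"
  have g: "0 \<le> g" using \<alpha> by (simp add: g_def)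
  let ?S = "root_factor \<alpha> xA"
  have S: "?S y > 0" for y using root_factor_pos xA by simp
  have root: "quartic \<alpha> (xA, xT, yT) y = 0 \<longleftrightarrow> (yT - y) * ?S y = g * y \<or> (y - yT) * ?S y = g * y"
    if "0 \<le> y" for y
  proof -
    have "\<bar>y - yT\<bar> * ?S y = g * y \<longleftrightarrow> (yT - y) * ?S y = g * y \<or> (y - yT) * ?S y = g * y"
    proof (cases "y \<le> yT")
      case True
      then have "(y - yT) * ?S y = g * y \<Longrightarrow> (yT - y) * ?S y = g * y"
        using S[of y] g that mult_nonneg_nonneg[of g y] mult_nonpos_nonneg[of "y - yT" "?S y"]
        by (smt (verit) mult_eq_0_iff)
      then show ?thesis using True by auto
    next
      case False
      then have "(yT - y) * ?S y < 0" using S by (simp add: mult_neg_pos)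
      then have "(yT - y) * ?S y \<noteq> g * y" using g that mult_nonneg_nonneg[of g y] by linarith
      then show ?thesis using False by simp
    qed
    then show ?thesis using that by (simp add: quartic_zero_iff g_def)
  qed
  obtain y1 where y1: "0 \<le> y1" "y1 \<le> yT" "(yT - y1) * ?S y1 = g * y1"
    using lower_root_exists xA g yT by blast
  \<comment> \<open>For \<open>yT = 0\<close> the second equation is also solved by 0, so it is
    unique only among positive solutions. A positive solution is preferred as \<open>y2\<close>, and
    0 is then already covered by \<open>y1\<close>.\<close>
  have "\<exists>y2\<ge>yT. (y2 - yT) * ?S y2 = g * y2 \<and> (\<forall>y\<ge>0. (y - yT) * ?S y = g * y \<longrightarrow> y = y1 \<or> y = y2)"
  proof (cases "yT > 0 \<or> (\<exists>y>0. (y - yT) * ?S y = g * y)")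
    case True
    then obtain y2 where y2: "0 < y2" "(y2 - yT) * ?S y2 = g * y2"
      using upper_root_exists xA g yT by (metis less_le_trans)
    moreover have "yT \<le> y2"
      using y2 S[of y2] g mult_nonneg_nonneg[of g y2] by (smt (verit) mult_neg_pos)
    moreover have "y = y1 \<or> y = y2" if y: "0 \<le> y" "(y - yT) * ?S y = g * y" for y
    proof (cases "y = 0")
      case True
      then have "yT = 0" using y S[of 0] by auto
      then show ?thesis using y1 True by auto
    next
      case False
      have "g > 0 \<or> yT > 0"
        using y2 S[of y2] g yT by (metis diff_zero less_eq_real_def mult_eq_0_iff mult_zero_left order_less_irrefl)
      then show ?thesis
        using upper_root_unique[OF xA g yT _ y2(1) _ y(2) y2(2)] False y by auto
    qed
    ultimately show ?thesis by blast
  next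
    case False
    then have "yT = 0" "\<And>y. 0 \<le> y \<Longrightarrow> (y - yT) * ?S y = g * y \<Longrightarrow> y = 0" using yT by force+
    then show ?thesis by (intro exI[of _ 0]) auto
  qed
  then obtain y2 where y2: "yT \<le> y2" "(y2 - yT) * ?S y2 = g * y2"
    "\<And>y. 0 \<le> y \<Longrightarrow> (y - yT) * ?S y = g * y \<Longrightarrow> y = y1 \<or> y = y2" by blast
  have "{y. 0 \<le> y \<and> quartic \<alpha> (xA, xT, yT) y = 0} = {y1, y2}"
  proof (intro equalityI subsetI)
    fix y assume "y \<in> {y. 0 \<le> y \<and> quartic \<alpha> (xA, xT, yT) y = 0}"
    then show "y \<in> {y1, y2}"
      using root lower_root_unique[OF xA g _ y1(1) _ y1(3), of y] y2(3) by auto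
  next
    fix y assume "y \<in> {y1, y2}"
    then show "y \<in> {y. 0 \<le> y \<and> quartic \<alpha> (xA, xT, yT) y = 0}"
      using root y1 y2 yT by auto
  qed
  then show ?thesis using y1 y2 by blast
qed

subsection \<open>Maximizers of the payoff\<close>

lemma lateral_sq: "(lateral \<alpha> \<beta>)\<^sup>2 = 1 - (\<alpha> * sin \<beta>)\<^sup>2"
  and lateral_pos: "0 < lateral \<alpha> \<beta>"
proof -
  have "(\<alpha> * sin \<beta>)\<^sup>2 \<le> \<alpha>\<^sup>2 * 1"
    unfolding power_mult_distrib by (intro mult_left_mono) (auto simp: abs_square_le_1)
  then have "(\<alpha> * sin \<beta>)\<^sup>2 < 1" using speed_ratio_sq_less_1 by simp
  then show "(lateral \<alpha> \<beta>)\<^sup>2 = 1 - (\<alpha> * sin \<beta>)\<^sup>2" "0 < lateral \<alpha> \<beta>"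
    by (auto simp: lateral_def)
qed

lemma lateral_le_1: "lateral \<alpha> \<beta> \<le> 1"
  by (simp add: lateral_def)

lemma lateral_sq': "(lateral \<alpha> \<beta>)\<^sup>2 = (cos \<beta>)\<^sup>2 + (1 - \<alpha>\<^sup>2) * (sin \<beta>)\<^sup>2"
  using sin_cos_squared_add[of \<beta>] unfolding lateral_sq by (simp add: power_mult_distrib algebra_simps)

lemma norm_retreat: "cmod (retreat \<alpha> \<beta>) = 1"
  using lateral_sq[of \<beta>] by (simp add: retreat_def cmod_def)

text \<open>A payoff is linear in \<open>(d, z)\<close> with coefficients bounded uniformly in
  \<beta>. The bound therefore passes to the supremum; comparison with \<open>(0, 0)\<close> shows
  that the supremum is finite.\<close>

lemma payoff_lipschitz: "payoff \<alpha> \<beta> d z \<le> payoff \<alpha> \<beta> d' z' + (\<bar>d - d'\<bar> + cmod (z - z'))"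
proof -
  have "payoff \<alpha> \<beta> d z - payoff \<alpha> \<beta> d' z' = \<alpha> * cos \<beta> * (d - d') / 2 + Re ((z - z') * cnj (retreat \<alpha> \<beta>))"
    by (simp add: payoff_def algebra_simps diff_divide_distrib)
  moreover have "Re ((z - z') * cnj (retreat \<alpha> \<beta>)) \<le> cmod (z - z')"
    using complex_Re_le_cmod[of "(z - z') * cnj (retreat \<alpha> \<beta>)"]
    by (simp add: norm_mult norm_retreat)
  moreover have "\<alpha> * cos \<beta> * (d - d') / 2 \<le> \<bar>d - d'\<bar>"
  proof -
    have "\<bar>\<alpha> * cos \<beta>\<bar> \<le> 1 * 1"
      unfolding abs_mult using \<alpha> by (intro mult_mono) auto
    then have "\<bar>\<alpha> * cos \<beta>\<bar> * \<bar>d - d'\<bar> \<le> 1 * \<bar>d - d'\<bar>" by (intro mult_right_mono) auto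
    then have "\<bar>\<alpha> * cos \<beta> * (d - d')\<bar> \<le> \<bar>d - d'\<bar>" by (simp add: abs_mult)
    then show ?thesis by linarith
  qed
  ultimately show ?thesis by linarith
qed

lemma payoff_le_game_value: "payoff \<alpha> \<beta> d z \<le> game_value \<alpha> d z"
  unfolding game_value_def
proof (rule cSUP_upper)
  show "bdd_above (range (\<lambda>\<beta>. payoff \<alpha> \<beta> d z))"
    using payoff_lipschitz[of _ d z 0 0]
    by (intro bdd_aboveI[of _ "\<bar>d\<bar> + cmod z"]) (auto simp: payoff_def)
qed simp

lemma game_value_lipschitz: "game_value \<alpha> d z \<le> game_value \<alpha> d' z' + (\<bar>d - d'\<bar> + cmod (z - z'))"
  unfolding game_value_def[of _ d]
proof (rule cSUP_least)
  fix \<beta>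
  show "payoff \<alpha> \<beta> d z \<le> game_value \<alpha> d' z' + (\<bar>d - d'\<bar> + cmod (z - z'))"
    using payoff_lipschitz[of \<beta> d z d' z'] payoff_le_game_value[of \<beta> d' z'] by linarith
qed simp

lemma tendsto_game_value:
  assumes "(d \<longlongrightarrow> d0) F" "(z \<longlongrightarrow> z0) F"
  shows "((\<lambda>t. game_value \<alpha> (d t) (z t)) \<longlongrightarrow> game_value \<alpha> d0 z0) F"
proof -
  have "((\<lambda>t. game_value \<alpha> (d t) (z t) - game_value \<alpha> d0 z0) \<longlongrightarrow> 0) F"
  proof (rule Lim_null_comparison)
    have "norm (game_value \<alpha> (d t) (z t) - game_value \<alpha> d0 z0) \<le> \<bar>d t - d0\<bar> + cmod (z t - z0)" for t
      using game_value_lipschitz[of "d t" "z t" d0 z0] game_value_lipschitz[of d0 z0 "d t" "z t"]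
      by (simp add: norm_minus_commute abs_minus_commute)
    then show "\<forall>\<^sub>F t in F. norm (game_value \<alpha> (d t) (z t) - game_value \<alpha> d0 z0) \<le> \<bar>d t - d0\<bar> + cmod (z t - z0)"
      by simp
    show "((\<lambda>t. \<bar>d t - d0\<bar> + cmod (z t - z0)) \<longlongrightarrow> 0) F"
      using assms by (auto intro!: tendsto_eq_intros)
  qed
  then show ?thesis by (rule LIM_zero_cancel)
qed

lemma game_value_eqI:
  assumes "\<And>\<beta>'. payoff \<alpha> \<beta>' d z \<le> payoff \<alpha> \<beta> d z"
  shows "game_value \<alpha> d z = payoff \<alpha> \<beta> d z"
  using payoff_le_game_value[of \<beta> d z] assms unfolding game_value_def
  by (intro antisym cSUP_least) auto

text \<open>Weighted Cauchy-Schwarz. A change of \<beta> turns the Target heading no more than the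
  Defender heading; this is the lower bound required for negative \<open>r\<close>.\<close>

lemma cos_diff_le_inner_retreat:
  "cos (\<beta> - \<beta>') \<le> Re (retreat \<alpha> \<beta> * cnj (retreat \<alpha> \<beta>'))"
proof -
  let ?k = "1 - \<alpha>\<^sup>2"
  have k: "0 \<le> ?k" using speed_ratio_sq_less_1 by simp
  have "(cos \<beta> * cos \<beta>' + ?k * (sin \<beta> * sin \<beta>'))\<^sup>2 \<le> (lateral \<alpha> \<beta> * lateral \<alpha> \<beta>')\<^sup>2"
    unfolding power_mult_distrib lateral_sq' by (rule weighted_Cauchy_Schwarz[OF k])
  then have "cos \<beta> * cos \<beta>' + ?k * (sin \<beta> * sin \<beta>') \<le> lateral \<alpha> \<beta> * lateral \<alpha> \<beta>'"
    using lateral_pos by (meson less_eq_real_def mult_pos_pos power2_le_imp_le)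
  then show ?thesis by (simp add: retreat_def cos_diff power2_eq_square algebra_simps)
qed

lemma payoff_aim_self:
  assumes "aim \<alpha> \<beta> \<tau> r d z"
  shows "payoff \<alpha> \<beta> d z = \<alpha> * \<tau> + r"
proof -
  have "retreat \<alpha> \<beta> * cnj (retreat \<alpha> \<beta>) = 1"
    by (simp add: complex_norm_square[symmetric] norm_retreat)
  then show ?thesis unfolding payoff_aim[OF assms] by simp
qed

text \<open>For \<open>r \<ge> 0\<close> both inner products are at most 1. For \<open>r < 0\<close>
  the second one is bounded from below by the first, which leaves
  \<open>(\<alpha> * \<tau> + r) * cos (\<beta> - \<beta>')\<close>, and the sign condition in
  \<open>aim\<close> concludes.\<close>

lemma payoff_aim_le:
  assumes "aim \<alpha> \<beta> \<tau> r d z"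
  shows "payoff \<alpha> \<beta>' d z \<le> \<alpha> * \<tau> + r"
proof -
  define q where "q = Re (retreat \<alpha> \<beta> * cnj (retreat \<alpha> \<beta>'))"
  have q: "cos (\<beta> - \<beta>') \<le> q" "q \<le> 1"
    using cos_diff_le_inner_retreat complex_Re_le_cmod[of "retreat \<alpha> \<beta> * cnj (retreat \<alpha> \<beta>')"]
    by (auto simp: q_def norm_mult norm_retreat)
  have \<tau>: "0 \<le> \<alpha> * \<tau>" "0 \<le> \<alpha> * \<tau> + r" using assms \<alpha> by (auto simp: aim_def)
  have "\<alpha> * \<tau> * cos (\<beta> - \<beta>') + r * q \<le> \<alpha> * \<tau> + r"
  proof (cases "0 \<le> r")
    case True
    then show ?thesis using q \<tau>
      by (intro add_mono) (auto intro: mult_left_le)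
  next
    case False
    have "\<alpha> * \<tau> * cos (\<beta> - \<beta>') + r * q \<le> (\<alpha> * \<tau> + r) * cos (\<beta> - \<beta>')"
      using mult_left_mono_neg[OF q(1), of r] False by (simp add: algebra_simps)
    also have "\<dots> \<le> \<alpha> * \<tau> + r" using \<tau>(2) by (intro mult_left_le) auto
    finally show ?thesis .
  qed
  then show ?thesis by (simp add: payoff_aim[OF assms] q_def)
qed

lemma game_value_aim:
  assumes "aim \<alpha> \<beta> \<tau> r d z"
  shows "game_value \<alpha> d z = \<alpha> * \<tau> + r"
  using game_value_eqI[of d z \<beta>] payoff_aim_le payoff_aim_self assms by auto

text \<open>The positivity of \<open>\<tau> + \<alpha> * r\<close> gives \<open>sin \<beta>\<close>
  the sign of \<open>Im z\<close>: the interception point lies on the Target's side of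
  \<open>AD\<close>.\<close>

lemma Im_aim:
  assumes "aim \<alpha> \<beta> \<tau> r d z"
  shows "Im z = sin \<beta> * (\<tau> + \<alpha> * r)" "0 < \<tau> + \<alpha> * r" "Re z = - r * lateral \<alpha> \<beta>"
proof -
  have "0 \<le> \<alpha> * (\<alpha> * \<tau> + r)" using assms \<alpha> unfolding aim_def by (intro mult_nonneg_nonneg) auto
  moreover have "\<alpha>\<^sup>2 * \<tau> < 1 * \<tau>"
    using assms speed_ratio_sq_less_1 unfolding aim_def by (intro mult_strict_right_mono) auto
  ultimately show "0 < \<tau> + \<alpha> * r" by (simp add: algebra_simps power2_eq_square)
qed (use assms in \<open>auto simp: aim_def retreat_def algebra_simps\<close>)

section \<open>The escape region and the admissible root\<close>

text \<open>By weighted Cauchy-Schwarz \<open>xA * cos \<beta> + yT * sin \<beta>\<close> is at most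
  \<open>lateral \<alpha> \<beta>\<close> times the square root of
  \<open>xA\<^sup>2 + yT\<^sup>2 / (1 - \<alpha>\<^sup>2)\<close>, the expression that bounds the
  region.\<close>

lemma escape_if_payoff_pos:
  assumes "0 < payoff \<alpha> \<beta> (2 * xA) (Complex xT yT)" "0 \<le> xA" "0 \<le> yT"
  shows "(xA, xT, yT) \<in> escape_region \<alpha>"
proof (cases "xT \<le> 0")
  case True
  then show ?thesis using assms by (auto simp: escape_region_def)
next
  case False
  let ?k = "1 - \<alpha>\<^sup>2" and ?c = "lateral \<alpha> \<beta>"
  have k: "0 < ?k" using speed_ratio_sq_less_1 by simp
  have less: "xT * ?c < \<alpha> * (xA * cos \<beta> + yT * sin \<beta>)"
    using assms by (simp add: payoff_def retreat_def algebra_simps)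
  moreover have "0 < xT * ?c" using False lateral_pos by simp
  ultimately have "\<alpha> \<noteq> 0" by auto
  with \<alpha> have "0 < \<alpha>" by simp
  have "(xT * ?c)\<^sup>2 < (\<alpha> * (xA * cos \<beta> + yT * sin \<beta>))\<^sup>2"
    using less \<open>0 < xT * ?c\<close> by (intro power_strict_mono) auto
  also have "(xA * cos \<beta> + yT * sin \<beta>)\<^sup>2 \<le> (xA\<^sup>2 + yT\<^sup>2 / ?k) * ?c\<^sup>2"
    using weighted_Cauchy_Schwarz[of ?k xA "cos \<beta>" "yT / ?k" "sin \<beta>"] k
    unfolding lateral_sq' by (simp add: power_divide) (simp add: power2_eq_square)
  then have "(\<alpha> * (xA * cos \<beta> + yT * sin \<beta>))\<^sup>2 \<le> \<alpha>\<^sup>2 * ((xA\<^sup>2 + yT\<^sup>2 / ?k) * ?c\<^sup>2)"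
    by (simp add: power_mult_distrib mult_left_mono)
  finally have "xT\<^sup>2 * ?c\<^sup>2 < \<alpha>\<^sup>2 * (xA\<^sup>2 + yT\<^sup>2 / ?k) * ?c\<^sup>2"
    by (simp add: power_mult_distrib mult.assoc)
  then have "xT\<^sup>2 < \<alpha>\<^sup>2 * (xA\<^sup>2 + yT\<^sup>2 / ?k)"
    by (rule mult_less_cancel_right_pos[THEN iffD1, rotated]) (rule zero_less_power[OF lateral_pos])
  then have "xT\<^sup>2 / \<alpha>\<^sup>2 < xA\<^sup>2 + yT\<^sup>2 / ?k"
    using \<open>0 < \<alpha>\<close> by (simp add: pos_divide_less_eq mult.commute)
  then show ?thesis using assms False \<open>0 < \<alpha>\<close> by (simp add: escape_region_def)
qed

text \<open>The bound on \<open>xT\<close> says that the signed terminal separation at the root is nonnegative.\<close>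

lemma signed_root_unique:
  assumes "0 < xA" "0 \<le> y" "0 \<le> y'" "xT \<le> \<alpha> * root_factor \<alpha> xA y" "xT \<le> \<alpha> * root_factor \<alpha> xA y'"
    and "(y - yT) * root_factor \<alpha> xA y = \<alpha> * xT * y" "(y' - yT) * root_factor \<alpha> xA y' = \<alpha> * xT * y'"
  shows "y = y'"
proof -
  have "False" if "0 \<le> u" "u < v" "xT \<le> \<alpha> * root_factor \<alpha> xA u"
      "(u - yT) * root_factor \<alpha> xA u = \<alpha> * xT * u" "(v - yT) * root_factor \<alpha> xA v = \<alpha> * xT * v" for u v
  proof -
    let ?S = "root_factor \<alpha> xA"
    have S: "0 < ?S u" "?S u < ?S v"
      using that assms root_factor_pos root_factor_mono by auto
    have "u - yT = \<alpha> * xT * (u / ?S u)" "v - yT = \<alpha> * xT * (v / ?S v)"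
      using that S by (auto simp: field_simps)
    then have diff: "v - u = \<alpha> * xT * (v / ?S v - u / ?S u)" by (simp add: algebra_simps)
    have mono: "0 \<le> v / ?S v - u / ?S u"
      using ratio_root_factor_mono[of xA u v] that assms by simp
    have "v / ?S v \<le> v / ?S u" using S that by (intro divide_left_mono) auto
    then have slope: "v / ?S v - u / ?S u \<le> (v - u) / ?S u" by (simp add: diff_divide_distrib)
    \<comment> \<open>The bound on \<open>xT\<close> limits the growth of
      \<open>\<alpha> * xT * (y / ?S y)\<close> from \<open>u\<close> to \<open>v\<close> to at most
      \<open>\<alpha>\<^sup>2\<close> times that of \<open>y\<close>, so two solutions cannot
      differ.\<close>
    have "\<alpha> * xT \<le> \<alpha> * (\<alpha> * ?S u)" using that \<alpha> by (intro mult_left_mono) auto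
    then have "v - u \<le> \<alpha> * (\<alpha> * ?S u) * (v / ?S v - u / ?S u)"
      unfolding diff using mono by (intro mult_right_mono)
    also have "\<dots> \<le> \<alpha> * (\<alpha> * ?S u) * ((v - u) / ?S u)"
      using slope \<alpha> S by (intro mult_left_mono) auto
    also have "\<dots> = \<alpha>\<^sup>2 * (v - u)" using S by (simp add: power2_eq_square)
    also have "\<dots> < 1 * (v - u)" using speed_ratio_sq_less_1 that by (intro mult_strict_right_mono) auto
    finally show False by simp
  qed
  then show ?thesis using assms by (metis linorder_neqE_linordered_idom)
qed

text \<open>If the bound failed, the root equation would give
  \<open>yT \<le> (1 - \<alpha>\<^sup>2) * y\<close>. Then the squared root factor is at least
  \<open>xA\<^sup>2 + yT\<^sup>2 / (1 - \<alpha>\<^sup>2)\<close>, against membership in the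
  region.\<close>

lemma escape_region_root_bound:
  assumes "(xA, xT, yT) \<in> escape_region \<alpha>" "0 < xA" "0 < xT" "0 \<le> yT" "yT \<le> y"
    and root: "(y - yT) * root_factor \<alpha> xA y = \<alpha> * xT * y"
  shows "xT < \<alpha> * root_factor \<alpha> xA y"
proof (rule ccontr)
  let ?S = "root_factor \<alpha> xA y" and ?k = "1 - \<alpha>\<^sup>2"
  have S: "0 < ?S" using root_factor_pos assms by simp
  have k: "0 < ?k" using speed_ratio_sq_less_1 by simp
  assume "\<not> ?thesis"
  then have gt: "\<alpha> * ?S \<le> xT" by simp
  have esc: "0 < \<alpha>" "xT\<^sup>2 / \<alpha>\<^sup>2 < xA\<^sup>2 + yT\<^sup>2 / ?k"
    using assms(1,3) by (auto simp: escape_region_def)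
  have "yT \<le> ?k * y"
  proof -
    have "\<alpha> * (\<alpha> * ?S) * y \<le> \<alpha> * xT * y"
      using gt \<alpha> assms by (intro mult_right_mono mult_left_mono) auto
    then have "(\<alpha>\<^sup>2 * y) * ?S \<le> (y - yT) * ?S"
      unfolding root by (simp add: power2_eq_square mult_ac)
    then have "\<alpha>\<^sup>2 * y \<le> y - yT" using S by simp
    then show ?thesis by (simp add: algebra_simps)
  qed
  then have "yT\<^sup>2 \<le> (?k * y)\<^sup>2" using assms by (intro power_mono) auto
  then have "yT\<^sup>2 / ?k \<le> ?k * y\<^sup>2" using k by (simp add: power2_eq_square field_simps)
  then have "xT\<^sup>2 / \<alpha>\<^sup>2 < ?S\<^sup>2" using esc k by (simp add: root_factor_def)
  then have "xT\<^sup>2 < (\<alpha> * ?S)\<^sup>2" using esc(1) by (simp add: pos_divide_less_eq power_mult_distrib mult.commute)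
  moreover have "(\<alpha> * ?S)\<^sup>2 \<le> xT\<^sup>2" using gt S \<alpha> by (intro power_mono) auto
  ultimately show False by simp
qed

lemma root_factor_aim:
  assumes "aim \<alpha> \<beta> \<tau> r (2 * xA) z"
  shows "root_factor \<alpha> xA (\<tau> * sin \<beta>) = \<tau> * lateral \<alpha> \<beta>"
proof -
  have "xA\<^sup>2 + (1 - \<alpha>\<^sup>2) * (\<tau> * sin \<beta>)\<^sup>2 = \<tau>\<^sup>2 * ((cos \<beta>)\<^sup>2 + (1 - \<alpha>\<^sup>2) * (sin \<beta>)\<^sup>2)"
    using assms by (simp add: aim_def power_mult_distrib distrib_left mult.left_commute)
  then have "xA\<^sup>2 + (1 - \<alpha>\<^sup>2) * (\<tau> * sin \<beta>)\<^sup>2 = (\<tau> * lateral \<alpha> \<beta>)\<^sup>2"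
    unfolding power_mult_distrib lateral_sq' .
  moreover have "0 \<le> \<tau> * lateral \<alpha> \<beta>" using assms lateral_pos[of \<beta>] by (auto simp: aim_def)
  ultimately show ?thesis by (simp add: root_factor_def)
qed

text \<open>A root \<open>y\<close> is an interception point on the bisector; direction and distance
  from the Defender give \<beta> and \<tau>. The first coordinate forces
  \<open>r = - xT / lateral \<alpha> \<beta>\<close>, and the second one is the root equation. The
  strict alternative for \<open>xT > 0\<close> later keeps optimal play inside the region.\<close>

lemma aim_exists:
  assumes esc: "(xA, xT, yT) \<in> escape_region \<alpha>" and xA: "0 < xA" and yT: "0 \<le> yT"
  shows "\<exists>\<beta> \<tau> r. aim \<alpha> \<beta> \<tau> r (2 * xA) (Complex xT yT) \<and> (xT \<le> 0 \<or> 0 < \<alpha> * \<tau> + r)"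
proof -
  let ?S = "root_factor \<alpha> xA"
  have S: "0 < ?S y" for y using root_factor_pos[OF xA] by simp
  have "\<exists>y\<ge>0. (y - yT) * ?S y = \<alpha> * xT * y \<and> xT \<le> \<alpha> * ?S y \<and> (xT \<le> 0 \<or> xT < \<alpha> * ?S y)"
  proof (cases "xT \<le> 0")
    case True
    then obtain y where y: "0 \<le> y" "(yT - y) * ?S y = \<alpha> * (- xT) * y"
      using lower_root_exists[OF xA, of "\<alpha> * (- xT)" yT] \<alpha> yT by (auto simp: mult_nonneg_nonpos)
    moreover have "0 \<le> \<alpha> * ?S y" using \<alpha> S[of y] by simp
    ultimately show ?thesis using True
      by (intro exI[of _ y]) (auto simp: algebra_simps)
  next
    case False
    then obtain y where y: "yT \<le> y" "(y - yT) * ?S y = \<alpha> * xT * y"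
      using upper_root_exists[OF xA, of "\<alpha> * xT" yT] \<alpha> yT by auto
    moreover have "xT < \<alpha> * ?S y"
      using escape_region_root_bound[OF esc xA _ yT y] False by simp
    ultimately show ?thesis using yT by (intro exI[of _ y]) auto
  qed
  then obtain y where y: "0 \<le> y" "(y - yT) * ?S y = \<alpha> * xT * y" "xT \<le> \<alpha> * ?S y"
    "xT \<le> 0 \<or> xT < \<alpha> * ?S y" by blast
  define \<tau> where "\<tau> = sqrt (xA\<^sup>2 + y\<^sup>2)"
  have \<tau>: "0 < \<tau>" "\<tau>\<^sup>2 = xA\<^sup>2 + y\<^sup>2" using xA by (auto simp: \<tau>_def add_pos_nonneg)
  have "(xA / \<tau>)\<^sup>2 + (y / \<tau>)\<^sup>2 = 1" using \<tau> xA
    by (simp add: power_divide sum_power2_eq_zero_iff flip: add_divide_distrib)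
  then obtain \<beta> where "xA / \<tau> = cos \<beta>" "y / \<tau> = sin \<beta>" using sincos_total_2pi by metis
  then have \<beta>: "xA = \<tau> * cos \<beta>" "y = \<tau> * sin \<beta>" using \<tau> by (auto simp: field_simps)
  let ?c = "lateral \<alpha> \<beta>"
  have c: "0 < ?c" using lateral_pos by simp
  have Sy: "?S y = \<tau> * ?c"
  proof -
    have "xA\<^sup>2 + (1 - \<alpha>\<^sup>2) * y\<^sup>2 = \<tau>\<^sup>2 * ((cos \<beta>)\<^sup>2 + (1 - \<alpha>\<^sup>2) * (sin \<beta>)\<^sup>2)"
      unfolding \<beta> by (simp add: power_mult_distrib distrib_left mult.left_commute)
    then have "xA\<^sup>2 + (1 - \<alpha>\<^sup>2) * y\<^sup>2 = (\<tau> * ?c)\<^sup>2"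
      unfolding power_mult_distrib lateral_sq' .
    then show ?thesis using \<tau> c by (simp add: root_factor_def)
  qed
  have "aim \<alpha> \<beta> \<tau> (- xT / ?c) (2 * xA) (Complex xT yT)"
    unfolding aim_def
  proof (intro conjI)
    show "0 < cos \<beta>" using \<beta>(1) xA \<tau> by (simp add: zero_less_mult_iff)
    have "(y - yT) * ?c = \<alpha> * xT * sin \<beta>" using y(2) \<tau> unfolding Sy by (simp add: \<beta>(2))
    then show "Complex xT yT = Complex 0 (\<tau> * sin \<beta>) + complex_of_real (- xT / ?c) * retreat \<alpha> \<beta>"
      using c by (simp add: complex_eq_iff retreat_def \<beta>(2)[symmetric] field_simps)
    show "0 \<le> \<alpha> * \<tau> + - xT / ?c" using y(3) c unfolding Sy by (simp add: field_simps)
  qed (use \<tau> \<beta> in auto)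
  moreover have "xT \<le> 0 \<or> 0 < \<alpha> * \<tau> + - xT / ?c" using y(4) c unfolding Sy by (auto simp: field_simps)
  ultimately show ?thesis by blast
qed

text \<open>The selected root and \<open>\<tau> * sin \<beta>\<close> solve the same signed equation
  with nonnegative separation, hence agree. The square roots in the laws then become \<tau> and the
  absolute value of \<open>r\<close>.\<close>

lemma control_laws_aim:
  fixes xA xT yT :: real
  defines "s \<equiv> (xA, xT, yT)"
  assumes roots: "{y. 0 \<le> y \<and> quartic \<alpha> s y = 0} = {y1 s, y2 s}" "y1 s \<le> yT" "yT \<le> y2 s"
    and laws: "control_laws \<alpha> y1 y2 chi phi psi s"
    and esc: "s \<in> escape_region \<alpha>" and xA: "0 < xA" and yT: "0 \<le> yT"
    and aim: "aim \<alpha> \<beta> \<tau> r (2 * xA) (Complex xT yT)"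
  shows "cis (chi s) = Complex (- cos \<beta>) (sin \<beta>)" "cis (psi s) = cis \<beta>"
    "cis (phi s) = retreat \<alpha> \<beta>"
proof -
  let ?S = "root_factor \<alpha> xA" and ?c = "lateral \<alpha> \<beta>"
  define y where "y = (if xT \<le> 0 then y1 s else y2 s)"
  have S: "0 < ?S u" for u using root_factor_pos[OF xA] by simp
  have c: "0 < ?c" using lateral_pos by simp
  have "quartic \<alpha> s y = 0" and y0: "0 \<le> y" using roots(1) by (auto simp: y_def)
  then have "\<bar>y - yT\<bar> * ?S y = \<alpha> * \<bar>xT\<bar> * y"
    unfolding s_def quartic_zero_iff by simp
  then have y: "(y - yT) * ?S y = \<alpha> * xT * y"
    using roots(2,3) by (auto simp: y_def algebra_simps split: if_splits)
  have le: "xT \<le> \<alpha> * ?S y"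
  proof (cases "xT \<le> 0")
    case True
    then show ?thesis using S[of y] \<alpha> mult_nonneg_nonneg[of \<alpha> "?S y"] by linarith
  next
    case False
    then show ?thesis using escape_region_root_bound[OF esc[unfolded s_def] xA _ yT _ y] roots(3)
      by (simp add: y_def less_imp_le)
  qed
  have \<tau>: "0 < \<tau>" "0 < cos \<beta>" "xA = \<tau> * cos \<beta>" using aim by (auto simp: aim_def)
  have xT: "xT = - r * ?c" using Im_aim[OF aim] by simp
  have yT_eq: "yT = \<tau> * sin \<beta> + r * (\<alpha> * sin \<beta>)"
    using Im_aim[OF aim] by (simp add: algebra_simps)
  have "0 \<le> sin \<beta>" using Im_aim(1,2)[OF aim] yT by (simp add: zero_le_mult_iff)
  have y_eq: "y = \<tau> * sin \<beta>"
  proof (rule signed_root_unique[OF xA y0 _ le _ y])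
    show "0 \<le> \<tau> * sin \<beta>" using \<open>0 \<le> sin \<beta>\<close> \<tau> by simp
    show "(\<tau> * sin \<beta> - yT) * ?S (\<tau> * sin \<beta>) = \<alpha> * xT * (\<tau> * sin \<beta>)"
      unfolding root_factor_aim[OF aim] by (simp add: xT yT_eq algebra_simps)
    have "0 \<le> (\<alpha> * \<tau> + r) * ?c" using aim c by (simp add: aim_def)
    then show "xT \<le> \<alpha> * ?S (\<tau> * sin \<beta>)"
      unfolding root_factor_aim[OF aim] by (simp add: xT algebra_simps)
  qed
  have "xA\<^sup>2 + y\<^sup>2 = \<tau>\<^sup>2" unfolding y_eq \<tau>(3) power_mult_distrib
    by (simp flip: distrib_left)
  then have norm_I: "sqrt (xA\<^sup>2 + y\<^sup>2) = \<tau>" using \<tau> by simp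
  have law: "cos (chi s) = - xA / \<tau> \<and> sin (chi s) = y / \<tau> \<and> cos (psi s) = xA / \<tau> \<and> sin (psi s) = y / \<tau>"
    using laws norm_I unfolding s_def control_laws_def prod.case Let_def
    by (auto simp: y_def s_def)
  then show "cis (chi s) = Complex (- cos \<beta>) (sin \<beta>)" "cis (psi s) = cis \<beta>"
    using \<tau> y_eq by (auto simp: complex_eq_iff)
  have TI: "xT = r * (- ?c)" "yT - y = r * (\<alpha> * sin \<beta>)"
    using xT yT_eq y_eq by auto
  show "cis (phi s) = retreat \<alpha> \<beta>"
  proof (cases "xT = 0")
    case False
    have "xT\<^sup>2 + (yT - y)\<^sup>2 = r\<^sup>2"
      unfolding TI power_mult_distrib[of r] using lateral_sq[of \<beta>] by (simp flip: distrib_left)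
    then have sq: "sqrt (xT\<^sup>2 + (yT - y)\<^sup>2) = \<bar>r\<bar>" by simp
    have "cos (phi s) = (if xT < 0 then 1 else - 1) * (xT / \<bar>r\<bar>)
      \<and> sin (phi s) = (if xT < 0 then 1 else - 1) * ((yT - y) / \<bar>r\<bar>)"
      using laws sq False unfolding s_def control_laws_def prod.case Let_def
      by (auto simp: y_def s_def)
    moreover have "r \<noteq> 0" "xT < 0 \<longleftrightarrow> 0 < r" using False xT c by (auto simp: zero_less_mult_iff)
    ultimately show ?thesis unfolding TI
      by (auto simp: complex_eq_iff retreat_def)
  next
    case True
    then have "r = 0" using xT c by simp
    then have yT_eq': "yT = \<tau> * sin \<beta>" using yT_eq by simp
    obtain \<theta> where \<theta>: "\<theta> \<in> {0..pi/2}" "phi s = \<theta> + pi/2" "\<alpha> * yT = 0 \<Longrightarrow> \<theta> = pi/2"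
      "\<alpha> * yT \<noteq> 0 \<Longrightarrow> tan \<theta> = ?S yT / (\<alpha> * yT)"
      using laws True unfolding s_def control_laws_def prod.case Let_def root_factor_def
      by (auto split: if_splits)
    \<comment> \<open>Here the Target sits at the interception point, so no vector between them
      defines a heading. With these values a quarter turn of \<open>cis \<theta>\<close> is
      \<open>retreat \<alpha> \<beta>\<close>.\<close>
    have "cos \<theta> = \<alpha> * sin \<beta> \<and> sin \<theta> = ?c"
    proof (cases "\<alpha> * yT = 0")
      case True
      then have "\<alpha> * sin \<beta> = 0" using yT_eq' \<tau> by auto
      then show ?thesis unfolding \<theta>(3)[OF True] by (simp add: lateral_def)
    next
      case False
      then have nz: "\<alpha> * sin \<beta> > 0" using yT_eq' \<open>0 \<le> sin \<beta>\<close> \<alpha> by (auto simp: less_le)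
      have "tan \<theta> = ?c / (\<alpha> * sin \<beta>)"
        using \<theta>(4)[OF False] \<tau> unfolding yT_eq' root_factor_aim[OF aim] by (simp add: field_simps)
      then have "0 < tan \<theta>" using nz c by simp
      then have "cos \<theta> \<noteq> 0" by (auto simp: tan_def)
      moreover have "0 \<le> cos \<theta>" "0 \<le> sin \<theta>" using \<theta>(1) by (auto intro: cos_ge_zero sin_ge_zero)
      ultimately have pos: "0 < cos \<theta>" by simp
      have "sin \<theta> / cos \<theta> = ?c / (\<alpha> * sin \<beta>)" using \<open>tan \<theta> = _\<close> by (simp add: tan_def)
      then have s: "sin \<theta> * (\<alpha> * sin \<beta>) = ?c * cos \<theta>"
        using pos nz by (metis frac_eq_eq less_irrefl)
      have "(cos \<theta>)\<^sup>2 = (\<alpha> * sin \<beta>)\<^sup>2"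
      proof -
        have "(sin \<theta>)\<^sup>2 * (\<alpha> * sin \<beta>)\<^sup>2 = ?c\<^sup>2 * (cos \<theta>)\<^sup>2"
          using s by (metis power_mult_distrib)
        then show ?thesis unfolding lateral_sq sin_squared_eq[of \<theta>] by algebra
      qed
      then have cos: "cos \<theta> = \<alpha> * sin \<beta>" using pos nz by (simp add: power2_eq_iff_nonneg)
      have "sin \<theta> = ?c" using s nz unfolding cos by (metis less_numeral_extra(3) mult_right_cancel)
      with cos show ?thesis by simp
    qed
    then show ?thesis unfolding \<theta>(2)
      by (auto simp: complex_eq_iff retreat_def cos_add sin_add)
  qed
qed

subsection \<open>Value along a play\<close>

text \<open>In the rotation term the part of \<open>z\<close> along the Target heading drops out,
  and \<tau> cancels against \<open>N = 2 * \<tau> * cos \<beta>\<close>. The coefficients thus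
  depend on \<beta> only, and the terms of \<open>a\<close> and \<open>d\<close> combine into inner
  products with the optimal courses.\<close>

lemma payoff_rate_aim:
  assumes "aim \<alpha> \<beta> \<tau> r N z"
  shows "\<alpha> * cos \<beta> * Re (a - d) / 2 + Re ((w - (a + d) / 2) * cnj (retreat \<alpha> \<beta>))
      + Im (a - d) * Im (z * cnj (retreat \<alpha> \<beta>)) / N
    = Re (w * cnj (retreat \<alpha> \<beta>)) + attacker_rate \<alpha> \<beta> * Re (a * cis \<beta>)
      + defender_rate \<alpha> \<beta> * Re (d * cnj (cis \<beta>))"
proof -
  have pos: "0 < cos \<beta>" "0 < \<tau>" "N = 2 * \<tau> * cos \<beta>" using assms by (auto simp: aim_def)
  have "Im (z * cnj (retreat \<alpha> \<beta>)) = - lateral \<alpha> \<beta> * \<tau> * sin \<beta>"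
    using assms by (auto simp: aim_def retreat_def algebra_simps)
  then have "Im (z * cnj (retreat \<alpha> \<beta>)) / N = - (lateral \<alpha> \<beta> * sin \<beta>) / (2 * cos \<beta>)"
    using pos by (simp del: times_complex.simps)
  then have eq: "Im (a - d) * Im (z * cnj (retreat \<alpha> \<beta>)) / N
      = Im (a - d) * (- (lateral \<alpha> \<beta> * sin \<beta>) / (2 * cos \<beta>))"
    by (simp only: times_divide_eq_right[symmetric])
  show ?thesis unfolding eq using pos(1)
    by (simp add: attacker_rate_def defender_rate_def retreat_def field_simps)
qed

text \<open>From \<open>(lateral \<alpha> \<beta> - \<alpha> * cos \<beta>) * (lateral \<alpha>
  \<beta> + \<alpha> * cos \<beta>) = 1 - \<alpha>\<^sup>2\<close>, where the second factor is at
  most 2. The growth like \<open>1 / cos \<beta>\<close> is what makes deviations close to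
  \<open>D\<close> expensive.\<close>

lemma defender_rate_ge:
  assumes "0 < cos \<beta>"
  shows "(1 - \<alpha>\<^sup>2) / (4 * cos \<beta>) \<le> defender_rate \<alpha> \<beta>"
proof -
  let ?c = "lateral \<alpha> \<beta>"
  have c: "0 < ?c" "?c \<le> 1" using lateral_pos lateral_le_1 by auto
  have b: "0 \<le> \<alpha> * cos \<beta>" "\<alpha> * cos \<beta> \<le> 1"
    using \<alpha> assms mult_le_one[of \<alpha> "cos \<beta>"] by auto
  have eq: "(?c - \<alpha> * cos \<beta>) * (?c + \<alpha> * cos \<beta>) = 1 - \<alpha>\<^sup>2"
  proof -
    have "?c\<^sup>2 - \<alpha>\<^sup>2 * (cos \<beta>)\<^sup>2 = 1 - \<alpha>\<^sup>2"
      unfolding lateral_sq power_mult_distrib cos_squared_eq by (simp add: algebra_simps)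
    then show ?thesis by (simp add: power2_eq_square algebra_simps)
  qed
  have "0 < 1 - \<alpha>\<^sup>2" using speed_ratio_sq_less_1 by simp
  then have "0 < ?c - \<alpha> * cos \<beta>" using eq c b by (metis add_pos_nonneg zero_less_mult_pos2)
  then have "(1 - \<alpha>\<^sup>2) \<le> (?c - \<alpha> * cos \<beta>) * 2"
    unfolding eq[symmetric] using c b by (intro mult_left_mono) auto
  then have "(1 - \<alpha>\<^sup>2) / (4 * cos \<beta>) \<le> ((?c - \<alpha> * cos \<beta>) * 2) / (4 * cos \<beta>)"
    using assms by (intro divide_right_mono) auto
  moreover have "x * 2 / (4 * cos \<beta>) = x / (2 * cos \<beta>)" for x
    using assms by (simp add: field_simps)
  ultimately show ?thesis by (simp only: defender_rate_def)
qed

lemma active_aim: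
  assumes "active \<alpha> A D T"
  obtains \<beta> \<tau> r where "aim \<alpha> \<beta> \<tau> r (dist A D) (target_frame A D T)"
    "Re (target_frame A D T) \<le> 0 \<or> 0 < \<alpha> * \<tau> + r"
proof -
  define z where "z = target_frame A D T"
  obtain \<beta> \<tau> r where aim: "aim \<alpha> \<beta> \<tau> r (dist A D) (Complex (Re z) \<bar>Im z\<bar>)"
    and or: "Re z \<le> 0 \<or> 0 < \<alpha> * \<tau> + r"
    using aim_exists[of "dist A D / 2" "Re z" "\<bar>Im z\<bar>"] assms
    by (auto simp: active_def reduced_def z_def)
  show ?thesis
  proof (cases "0 \<le> Im z")
    case True
    then show ?thesis using aim or that unfolding z_def[symmetric] by (auto simp: complex_surj)
  next
    case False
    then have "cnj (Complex (Re z) \<bar>Im z\<bar>) = z" by (simp add: complex_eq_iff)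
    then show ?thesis using aim_reflect[OF aim] or that unfolding z_def[symmetric] by auto
  qed
qed

lemma escape_if_payoff_pos_plane:
  assumes "A \<noteq> D" "0 < payoff \<alpha> \<beta> (dist A D) (target_frame A D T) \<or> Re (target_frame A D T) \<le> 0"
  shows "active \<alpha> A D T"
proof -
  define z where "z = target_frame A D T"
  have "(dist A D / 2, Re z, \<bar>Im z\<bar>) \<in> escape_region \<alpha>"
  proof (cases "Re z \<le> 0")
    case True
    then show ?thesis by (auto simp: escape_region_def)
  next
    case False
    then have pos: "0 < payoff \<alpha> \<beta> (dist A D) z" using assms by (simp add: z_def)
    have "0 < payoff \<alpha> (if 0 \<le> Im z then \<beta> else - \<beta>) (2 * (dist A D / 2)) (Complex (Re z) \<bar>Im z\<bar>)"
      using pos by (auto simp: payoff_def retreat_uminus)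
    then show ?thesis by (rule escape_if_payoff_pos) auto
  qed
  then show ?thesis using assms by (simp add: active_def reduced_def z_def)
qed

lemma control_laws_optimal_laws:
  assumes roots: "\<forall>xA xT yT. 0 < xA \<and> 0 \<le> yT \<longrightarrow>
       {y. 0 \<le> y \<and> quartic \<alpha> (xA, xT, yT) y = 0} = {y1 (xA, xT, yT), y2 (xA, xT, yT)} \<and>
       y1 (xA, xT, yT) \<le> yT \<and> yT \<le> y2 (xA, xT, yT)"
    and laws: "\<forall>xA xT yT. 0 < xA \<and> 0 \<le> yT \<and> (xA, xT, yT) \<in> escape_region \<alpha> \<longrightarrow>
         control_laws \<alpha> y1 y2 chi phi psi (xA, xT, yT)"
  shows "optimal_laws \<alpha> chi phi psi"
  unfolding optimal_laws_def
proof (intro allI impI)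
  fix A D T \<beta> \<tau> r
  define z where "z = target_frame A D T"
  define s where "s = reduced A D T"
  assume act: "active \<alpha> A D T" and "aim \<alpha> \<beta> \<tau> r (dist A D) (target_frame A D T)"
  then have aim: "aim \<alpha> \<beta> \<tau> r (dist A D) z" by (simp add: z_def)
  have s: "s = (dist A D / 2, Re z, \<bar>Im z\<bar>)" by (simp add: s_def z_def reduced_def)
  have pos: "0 < dist A D / 2" "s \<in> escape_region \<alpha>" using act by (auto simp: active_def s_def)
  \<comment> \<open>Reflecting the state flips the sign of \<beta>; \<open>plane_direction\<close>
    flips it back.\<close>
  define \<beta>' where "\<beta>' = (if 0 \<le> Im z then \<beta> else - \<beta>)"
  have aim': "aim \<alpha> \<beta>' \<tau> r (2 * (dist A D / 2)) (Complex (Re z) \<bar>Im z\<bar>)"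
  proof (cases "0 \<le> Im z")
    case True
    then show ?thesis using aim by (simp add: \<beta>'_def complex_surj)
  next
    case False
    then have "cnj z = Complex (Re z) \<bar>Im z\<bar>" by (simp add: complex_eq_iff)
    then show ?thesis using aim_reflect[OF aim] False by (simp add: \<beta>'_def)
  qed
  have "cis (chi s) = Complex (- cos \<beta>') (sin \<beta>')" "cis (psi s) = cis \<beta>'" "cis (phi s) = retreat \<alpha> \<beta>'"
    using control_laws_aim[OF _ _ _ _ _ pos(1) _ aim', of y1 y2 chi phi psi] roots laws pos
    unfolding s by auto
  then show "plane_direction A D T (chi (reduced A D T)) = sgn (A - D) * Complex (- cos \<beta>) (sin \<beta>) \<and>
     plane_direction A D T (psi (reduced A D T)) = sgn (A - D) * cis \<beta> \<and>
     plane_direction A D T (phi (reduced A D T)) = sgn (A - D) * retreat \<alpha> \<beta>"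
    unfolding plane_direction_def s_def[symmetric] z_def[symmetric]
    by (auto simp: \<beta>'_def retreat_uminus complex_eq_iff)
qed

lemma continuous_on_play_value:
  assumes "continuous_on X A" "continuous_on X D" "continuous_on X T" "\<And>t. t \<in> X \<Longrightarrow> A t \<noteq> D t"
  shows "continuous_on X (play_value \<alpha> A D T)"
  unfolding continuous_on_def
proof
  fix t assume t: "t \<in> X"
  have lim: "(A \<longlongrightarrow> A t) (at t within X)" "(D \<longlongrightarrow> D t) (at t within X)" "(T \<longlongrightarrow> T t) (at t within X)"
    using assms t by (auto simp: continuous_on_def)
  have "((\<lambda>t. target_frame (A t) (D t) (T t)) \<longlongrightarrow> target_frame (A t) (D t) (T t)) (at t within X)"
    unfolding target_frame_def using assms(4)[OF t]
    by (intro tendsto_intros lim tendsto_sgn) auto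
  then show "(play_value \<alpha> A D T \<longlongrightarrow> play_value \<alpha> A D T t) (at t within X)"
    by (intro tendsto_game_value tendsto_dist lim)
qed

lemma payoff_derivative_along_play:
  assumes "(A has_vector_derivative cis (chi t)) (at t)" "(D has_vector_derivative cis (psi t)) (at t)"
    "(T has_vector_derivative of_real \<alpha> * cis (phi t)) (at t)" "A t \<noteq> D t"
    and aim: "aim \<alpha> \<beta> \<tau> r (dist (A t) (D t)) (target_frame (A t) (D t) (T t))"
  defines "n \<equiv> sgn (A t - D t)"
  shows "((\<lambda>t. payoff \<alpha> \<beta> (dist (A t) (D t)) (target_frame (A t) (D t) (T t))) has_real_derivative
     \<alpha> * Re (cis (phi t) * cnj n * cnj (retreat \<alpha> \<beta>))
       + attacker_rate \<alpha> \<beta> * Re (cis (chi t) * cnj n * cis \<beta>)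
       + defender_rate \<alpha> \<beta> * Re (cis (psi t) * cnj n * cnj (cis \<beta>))) (at t)"
proof -
  have 1: "(cis (chi t) - cis (psi t)) * cnj n = cis (chi t) * cnj n - cis (psi t) * cnj n"
    and 2: "(of_real \<alpha> * cis (phi t) - (cis (chi t) + cis (psi t)) / 2) * cnj n
      = of_real \<alpha> * (cis (phi t) * cnj n) - (cis (chi t) * cnj n + cis (psi t) * cnj n) / 2"
    and 3: "Re (of_real \<alpha> * (cis (phi t) * cnj n) * cnj (retreat \<alpha> \<beta>))
      = \<alpha> * Re (cis (phi t) * cnj n * cnj (retreat \<alpha> \<beta>))"
    by (auto simp: algebra_simps add_divide_distrib)
  show ?thesis
    using has_real_derivative_payoff[OF assms(1-4), of \<alpha> \<beta>]
    unfolding n_def[symmetric] 1 2 payoff_rate_aim[OF aim] 3 .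
qed

section \<open>Monotonicity of the value when one side uses its laws\<close>

text \<open>By \<open>rates_balance\<close> the rate is
  \<open>attacker_rate \<alpha> \<beta>\<close> times one plus the Attacker's inner product, which
  is at least \<open>- 1\<close>. The final time is included unless the players have met, as needed
  for staying in the region.\<close>

lemma play_value_nondecreasing:
  assumes laws: "optimal_laws \<alpha> chis phis psis" and ev: "evolution \<alpha> A D T chi psi phi \<tau>"
    and D: "follows psis A D T psi \<tau>" and T: "follows phis A D T phi \<tau>"
    and u: "0 \<le> u" "u \<le> \<tau>" "A u \<noteq> D u"
  shows "play_value \<alpha> A D T 0 \<le> play_value \<alpha> A D T u"
proof -
  obtain S where S: "countable S"
    "\<And>t. t \<in> {0<..<\<tau>} - S \<Longrightarrow> (A has_vector_derivative cis (chi t)) (at t)"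
    "\<And>t. t \<in> {0<..<\<tau>} - S \<Longrightarrow> (D has_vector_derivative cis (psi t)) (at t)"
    "\<And>t. t \<in> {0<..<\<tau>} - S \<Longrightarrow> (T has_vector_derivative of_real \<alpha> * cis (phi t)) (at t)"
    using evolution_derivatives[OF ev] by metis
  have act: "active \<alpha> (A t) (D t) (T t)" if "t \<in> {0..<\<tau>}" for t
    using ev that by (simp add: evolution_def)
  have ne: "A t \<noteq> D t" if "t \<in> {0..u}" for t
    using act[of t] u that by (cases "t = u") (auto simp: active_def)
  show ?thesis
  proof (rule nondecreasing_if_support_below[OF u(1) _ S(1)])
    show "continuous_on {0..u} (play_value \<alpha> A D T)"
      using evolution_continuous[OF ev] u ne
      by (intro continuous_on_play_value) (auto intro: continuous_on_subset)
  next
    fix t assume "t \<in> {0<..<u} - S"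
    then have t: "t \<in> {0<..<\<tau>} - S" "t \<in> {0..<\<tau>}" using u by auto
    have net: "A t \<noteq> D t" using act[OF t(2)] by (simp add: active_def)
    obtain \<beta> \<rho> r where aim: "aim \<alpha> \<beta> \<rho> r (dist (A t) (D t)) (target_frame (A t) (D t) (T t))"
      using active_aim[OF act[OF t(2)]] by blast
    define n where "n = sgn (A t - D t)"
    have law: "cis (psi t) = n * cis \<beta>" "cis (phi t) = n * retreat \<alpha> \<beta>"
      using D T t(2) optimal_lawsD[OF laws act[OF t(2)] aim] by (auto simp: follows_def n_def)
    have "cis (phi t) * cnj n * cnj (retreat \<alpha> \<beta>) = 1" "cis (psi t) * cnj n * cnj (cis \<beta>) = 1"
      unfolding law n_def sgn_times_cnj[OF net]
      by (simp_all add: complex_norm_square[symmetric] norm_retreat)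
    moreover have "- 1 \<le> Re (cis (chi t) * cnj n * cis \<beta>)"
    proof -
      have "cmod (cis (chi t) * cnj n * cis \<beta>) = 1" using net by (simp add: norm_mult n_def norm_sgn)
      then show ?thesis using abs_Re_le_cmod[of "cis (chi t) * cnj n * cis \<beta>"] by linarith
    qed
    moreover have c: "0 < cos \<beta>" using aim by (simp add: aim_def)
    have "0 \<le> attacker_rate \<alpha> \<beta>"
      unfolding attacker_rate_def using c lateral_pos[of \<beta>] \<alpha> by simp
    ultimately have rate_sign: "0 \<le> \<alpha> * Re (cis (phi t) * cnj n * cnj (retreat \<alpha> \<beta>))
       + attacker_rate \<alpha> \<beta> * Re (cis (chi t) * cnj n * cis \<beta>)
       + defender_rate \<alpha> \<beta> * Re (cis (psi t) * cnj n * cnj (cis \<beta>))"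
      using rates_balance[OF c] mult_left_mono[of "- 1" "Re (cis (chi t) * cnj n * cis \<beta>)" "attacker_rate \<alpha> \<beta>"]
      by simp
    show "\<exists>g g'. (g has_real_derivative g') (at t) \<and> g t = play_value \<alpha> A D T t
      \<and> (\<forall>s\<in>{0..u}. g s \<le> play_value \<alpha> A D T s) \<and> 0 \<le> g'"
    proof (intro exI conjI ballI)
      show "((\<lambda>t. payoff \<alpha> \<beta> (dist (A t) (D t)) (target_frame (A t) (D t) (T t))) has_real_derivative
          \<alpha> * Re (cis (phi t) * cnj n * cnj (retreat \<alpha> \<beta>))
            + attacker_rate \<alpha> \<beta> * Re (cis (chi t) * cnj n * cis \<beta>)
            + defender_rate \<alpha> \<beta> * Re (cis (psi t) * cnj n * cnj (cis \<beta>))) (at t)"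
        unfolding n_def by (rule payoff_derivative_along_play[where A = A and D = D and T = T and chi = chi and psi = psi and phi = phi and t = t,
            OF S(2-4)[OF t(1)] net aim])
      show "payoff \<alpha> \<beta> (dist (A t) (D t)) (target_frame (A t) (D t) (T t)) = play_value \<alpha> A D T t"
        using payoff_aim_self[OF aim] game_value_aim[OF aim] by simp
    qed (use rate_sign payoff_le_game_value in auto)
  qed
qed

text \<open>The Attacker contributes exactly \<open>- attacker_rate \<alpha> \<beta>\<close>, so
  what remains are the shortfalls of Target and Defender. The Defender's shortfall is kept
  quantitatively for the terminal estimate.\<close>

lemma attacker_law_rate:
  assumes laws: "optimal_laws \<alpha> chis phis psis" and act: "active \<alpha> A D T"
    and aim: "aim \<alpha> \<beta> \<tau> r (dist A D) (target_frame A D T)"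
    and chi: "cis chi = plane_direction A D T (chis (reduced A D T))"
  defines "n \<equiv> sgn (A - D)"
  shows "cis chi * cnj n = Complex (- cos \<beta>) (sin \<beta>)"
    and "\<alpha> * Re (cis phi * cnj n * cnj (retreat \<alpha> \<beta>)) + attacker_rate \<alpha> \<beta> * Re (cis chi * cnj n * cis \<beta>)
       + defender_rate \<alpha> \<beta> * Re (cis psi * cnj n * cnj (cis \<beta>))
     \<le> - ((1 - \<alpha>\<^sup>2) / (4 * cos \<beta>)) * (1 - Re (cis psi * cnj n * cnj (cis \<beta>)))"
proof -
  have ne: "A \<noteq> D" using act by (simp add: active_def)
  have "cis chi = n * Complex (- cos \<beta>) (sin \<beta>)"
    using optimal_lawsD(1)[OF laws act aim] chi by (simp add: n_def)
  then show a: "cis chi * cnj n = Complex (- cos \<beta>) (sin \<beta>)"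
    using sgn_times_cnj[OF ne] by (simp add: n_def)
  have "Re (cis chi * cnj n * cis \<beta>) = - (cos \<beta> * cos \<beta>) - sin \<beta> * sin \<beta>" unfolding a by simp
  then have re_a: "Re (cis chi * cnj n * cis \<beta>) = - 1" using sin_cos_squared_add3[of \<beta>] by linarith
  have n: "cmod n = 1" using ne by (simp add: n_def norm_sgn)
  have "Re (cis phi * cnj n * cnj (retreat \<alpha> \<beta>)) \<le> 1"
    using complex_Re_le_cmod[of "cis phi * cnj n * cnj (retreat \<alpha> \<beta>)"]
    by (simp add: norm_mult n norm_retreat)
  then have phi: "\<alpha> * Re (cis phi * cnj n * cnj (retreat \<alpha> \<beta>)) \<le> \<alpha>"
    using \<alpha> by (intro mult_left_le) auto
  define q where "q = Re (cis psi * cnj n * cnj (cis \<beta>))"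
  have q: "q \<le> 1"
    using complex_Re_le_cmod[of "cis psi * cnj n * cnj (cis \<beta>)"] unfolding q_def by (simp add: norm_mult n)
  have c: "0 < cos \<beta>" using aim by (simp add: aim_def)
  have "(1 - \<alpha>\<^sup>2) / (4 * cos \<beta>) * (1 - q) \<le> defender_rate \<alpha> \<beta> * (1 - q)"
    using defender_rate_ge[OF c] q by (intro mult_right_mono) auto
  then have "\<alpha> * Re (cis phi * cnj n * cnj (retreat \<alpha> \<beta>)) - attacker_rate \<alpha> \<beta> + defender_rate \<alpha> \<beta> * q
     \<le> - ((1 - \<alpha>\<^sup>2) / (4 * cos \<beta>)) * (1 - q)"
    using phi rates_balance[OF c] by (simp add: algebra_simps)
  then show "\<alpha> * Re (cis phi * cnj n * cnj (retreat \<alpha> \<beta>)) + attacker_rate \<alpha> \<beta> * Re (cis chi * cnj n * cis \<beta>)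
       + defender_rate \<alpha> \<beta> * Re (cis psi * cnj n * cnj (cis \<beta>))
     \<le> - ((1 - \<alpha>\<^sup>2) / (4 * cos \<beta>)) * (1 - Re (cis psi * cnj n * cnj (cis \<beta>)))"
    unfolding re_a q_def[symmetric] by simp
qed

lemma play_value_nonincreasing:
  assumes laws: "optimal_laws \<alpha> chis phis psis" and ev: "evolution \<alpha> A D T chi psi phi \<tau>"
    and chi: "follows chis A D T chi \<tau>" and u: "0 \<le> u" "u < \<tau>"
  shows "play_value \<alpha> A D T u \<le> play_value \<alpha> A D T 0"
proof -
  obtain S where S: "countable S"
    "\<And>t. t \<in> {0<..<\<tau>} - S \<Longrightarrow> (A has_vector_derivative cis (chi t)) (at t)"
    "\<And>t. t \<in> {0<..<\<tau>} - S \<Longrightarrow> (D has_vector_derivative cis (psi t)) (at t)"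
    "\<And>t. t \<in> {0<..<\<tau>} - S \<Longrightarrow> (T has_vector_derivative of_real \<alpha> * cis (phi t)) (at t)"
    using evolution_derivatives[OF ev] by metis
  have act: "active \<alpha> (A t) (D t) (T t)" if "t \<in> {0..<\<tau>}" for t
    using ev that by (simp add: evolution_def)
  have ne: "A t \<noteq> D t" if "t \<in> {0..u}" for t
    using act[of t] u that by (auto simp: active_def)
  show ?thesis
  proof (rule nonincreasing_if_support_below[OF u(1) _ S(1)])
    show "continuous_on {0..u} (play_value \<alpha> A D T)"
      using evolution_continuous[OF ev] u ne
      by (intro continuous_on_play_value) (auto intro: continuous_on_subset)
  next
    fix t assume "t \<in> {0<..<u} - S"
    then have t: "t \<in> {0<..<\<tau>} - S" "t \<in> {0..<\<tau>}" using u by auto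
    have net: "A t \<noteq> D t" using act[OF t(2)] by (simp add: active_def)
    obtain \<beta> \<rho> r where aim: "aim \<alpha> \<beta> \<rho> r (dist (A t) (D t)) (target_frame (A t) (D t) (T t))"
      using active_aim[OF act[OF t(2)]] by metis
    define n where "n = sgn (A t - D t)"
    define q where "q = Re (cis (psi t) * cnj n * cnj (cis \<beta>))"
    have q: "q \<le> 1"
      using complex_Re_le_cmod[of "cis (psi t) * cnj n * cnj (cis \<beta>)"] net
      unfolding q_def by (simp add: n_def norm_mult norm_sgn)
    have "cis (chi t) = plane_direction (A t) (D t) (T t) (chis (reduced (A t) (D t) (T t)))"
      using chi t by (simp add: follows_def)
    note rate = attacker_law_rate(2)[OF laws act[OF t(2)] aim this, of "phi t" "psi t", folded n_def, folded q_def]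
    have "0 \<le> (1 - \<alpha>\<^sup>2) / (4 * cos \<beta>)" using aim speed_ratio_sq_less_1 by (simp add: aim_def)
    then have "- ((1 - \<alpha>\<^sup>2) / (4 * cos \<beta>)) * (1 - q) \<le> 0" using q mult_nonneg_nonneg[of "(1 - \<alpha>\<^sup>2) / (4 * cos \<beta>)" "1 - q"]
      unfolding mult_minus_left by linarith
    then have rate_sign: "\<alpha> * Re (cis (phi t) * cnj n * cnj (retreat \<alpha> \<beta>))
        + attacker_rate \<alpha> \<beta> * Re (cis (chi t) * cnj n * cis \<beta>)
        + defender_rate \<alpha> \<beta> * Re (cis (psi t) * cnj n * cnj (cis \<beta>)) \<le> 0"
      using rate unfolding q_def by linarith
    show "\<exists>g g'. (g has_real_derivative g') (at t) \<and> g t = play_value \<alpha> A D T t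
      \<and> (\<forall>s\<in>{0..u}. g s \<le> play_value \<alpha> A D T s) \<and> g' \<le> 0"
    proof (intro exI conjI ballI)
      show "((\<lambda>t. payoff \<alpha> \<beta> (dist (A t) (D t)) (target_frame (A t) (D t) (T t))) has_real_derivative
          \<alpha> * Re (cis (phi t) * cnj n * cnj (retreat \<alpha> \<beta>))
            + attacker_rate \<alpha> \<beta> * Re (cis (chi t) * cnj n * cis \<beta>)
            + defender_rate \<alpha> \<beta> * Re (cis (psi t) * cnj n * cnj (cis \<beta>))) (at t)"
        unfolding n_def by (rule payoff_derivative_along_play[where A = A and D = D and T = T and chi = chi and psi = psi and phi = phi and t = t,
            OF S(2-4)[OF t(1)] net aim])
      show "payoff \<alpha> \<beta> (dist (A t) (D t)) (target_frame (A t) (D t) (T t)) = play_value \<alpha> A D T t"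
        using payoff_aim_self[OF aim] game_value_aim[OF aim] by simp
    qed (use rate_sign payoff_le_game_value in auto)
  qed
qed

section \<open>Terminal distance against the Attacker's law\<close>

text \<open>Triangle inequality through the interception point, at distance \<tau> from
  \<open>A\<close> and the absolute value of \<open>r\<close> from \<open>T\<close>.\<close>

lemma dist_aim:
  assumes "A \<noteq> D" and aim: "aim \<alpha> \<beta> \<tau> r (dist A D) (target_frame A D T)"
  shows "dist A T \<le> \<tau> + \<bar>r\<bar>"
proof -
  have z: "target_frame A D T = Complex 0 (\<tau> * sin \<beta>) + of_real r * retreat \<alpha> \<beta>"
    and d: "dist A D = 2 * \<tau> * cos \<beta>" and \<tau>: "0 < \<tau>" using aim by (auto simp: aim_def)
  have "target_frame A D T - of_real (dist A D / 2)
      = of_real \<tau> * Complex (- cos \<beta>) (sin \<beta>) + of_real r * retreat \<alpha> \<beta>"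
    unfolding z d by (simp add: complex_eq_iff)
  then have "dist A T = cmod (of_real \<tau> * Complex (- cos \<beta>) (sin \<beta>) + of_real r * retreat \<alpha> \<beta>)"
    using dist_target_frame[OF assms(1), of T] by simp
  also have "\<dots> \<le> cmod (of_real \<tau> * Complex (- cos \<beta>) (sin \<beta>)) + cmod (of_real r * retreat \<alpha> \<beta>)"
    by (rule norm_triangle_ineq)
  also have "cmod (Complex (- cos \<beta>) (sin \<beta>)) = 1" by (simp add: cmod_def)
  then have "cmod (of_real \<tau> * Complex (- cos \<beta>) (sin \<beta>)) + cmod (of_real r * retreat \<alpha> \<beta>) = \<tau> + \<bar>r\<bar>"
    using \<tau> by (simp add: norm_mult norm_retreat)
  finally show ?thesis .
qed

text \<open>The relative speed is at most 2. This forces the logarithm of the distance to minus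
  infinity at least as fast as that of the remaining time.\<close>

lemma evolution_dist_bound:
  assumes ev: "evolution \<alpha> A D T chi psi phi tf" and "A tf = D tf" and u: "0 \<le> u" "u \<le> tf"
  shows "dist (A u) (D u) \<le> 2 * (tf - u)"
proof -
  obtain S where S: "countable S"
    "\<And>t. t \<in> {0<..<tf} - S \<Longrightarrow> (A has_vector_derivative cis (chi t)) (at t)"
    "\<And>t. t \<in> {0<..<tf} - S \<Longrightarrow> (D has_vector_derivative cis (psi t)) (at t)"
    using evolution_derivatives[OF ev] by metis
  have "dist (A u) (D u) + 2 * u \<le> dist (A tf) (D tf) + 2 * tf"
  proof (rule nondecreasing_if_support_below[where f = "\<lambda>t. dist (A t) (D t) + 2 * t", OF u(2) _ S(1)])
    show "continuous_on {u..tf} (\<lambda>t. dist (A t) (D t) + 2 * t)"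
      using evolution_continuous[OF ev] u
      by (intro continuous_intros) (auto intro: continuous_on_subset)
  next
    fix t assume "t \<in> {u<..<tf} - S"
    then have t: "t \<in> {0<..<tf} - S" "t \<in> {0..<tf}" using u by auto
    have "A t \<noteq> D t" using ev t by (auto simp: evolution_def active_def)
    define p where "p = (cis (chi t) - cis (psi t)) * cnj (sgn (A t - D t))"
    have "((\<lambda>t. dist (A t) (D t) + 2 * t) has_real_derivative Re p + 2) (at t)"
      using has_real_derivative_dist[OF S(2,3)[OF t(1)] \<open>A t \<noteq> D t\<close>, folded p_def]
      by (auto intro!: derivative_eq_intros)
    moreover have "cmod p \<le> 2"
      using norm_triangle_ineq4[of "cis (chi t)" "cis (psi t)"] \<open>A t \<noteq> D t\<close>
      by (simp add: p_def norm_mult norm_sgn)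
    then have "0 \<le> Re p + 2" using abs_Re_le_cmod[of p] by linarith
    ultimately show "\<exists>g g'. (g has_real_derivative g') (at t) \<and> g t = dist (A t) (D t) + 2 * t
        \<and> (\<forall>s\<in>{u..tf}. g s \<le> dist (A s) (D s) + 2 * s) \<and> 0 \<le> g'"
      by blast
  qed
  then show ?thesis using assms(2) by simp
qed

text \<open>As \<open>A\<close> and \<open>D\<close> get close, the value may stay below the distance of \<open>A\<close> and \<open>T\<close>, but only while the
  optimal interception point keeps a distance of at least \<open>\<tau>0\<close> from \<open>A\<close>. Closing the gap without grazing then
  costs the Defender so much that the value would tend to \<open>- \<infinity>\<close>: the value plus a logarithmic
  penalty is nonincreasing, and the penalty tends to \<open>\<infinity>\<close>.\<close>

lemma terminal_dist_le_play_value: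
  assumes laws: "optimal_laws \<alpha> chis phis psis" and ev: "evolution \<alpha> A D T chi psi phi tf"
    and chi: "follows chis A D T chi tf" and hit: "A tf = D tf" and "nongrazing A D tf"
  shows "dist (A tf) (T tf) \<le> play_value \<alpha> A D T 0"
proof (rule ccontr)
  define N where "N t = dist (A t) (D t)" for t
  define V where "V = play_value \<alpha> A D T"
  define R where "R = dist (A tf) (T tf)"
  assume "\<not> ?thesis"
  then have less: "V 0 < R" by (simp add: V_def R_def)
  have tf: "0 < tf" using ev by (simp add: evolution_def)
  have act: "active \<alpha> (A t) (D t) (T t)" if "t \<in> {0..<tf}" for t
    using ev that by (simp add: evolution_def)
  have ne: "A t \<noteq> D t" if "t \<in> {0..<tf}" for t
    using act[OF that] by (simp add: active_def)
  have V0: "V t \<le> V 0" if "t \<in> {0..<tf}" for t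
    using play_value_nonincreasing[OF laws ev chi] that by (simp add: V_def)
  have V_nonneg: "0 \<le> V t" if t: "t \<in> {0..<tf}" for t
  proof -
    obtain \<beta> \<rho> r where "aim \<alpha> \<beta> \<rho> r (dist (A t) (D t)) (target_frame (A t) (D t) (T t))"
      using active_aim[OF act[OF t]] by metis
    then show ?thesis using game_value_aim by (simp add: V_def aim_def)
  qed
  obtain c where c: "0 < c" "\<And>t. t \<in> {0..tf} \<Longrightarrow> c * (tf - t) \<le> N t"
    using assms(5) by (auto simp: nongrazing_def N_def)
  obtain S where S: "countable S"
    "\<And>t. t \<in> {0<..<tf} - S \<Longrightarrow> (A has_vector_derivative cis (chi t)) (at t)"
    "\<And>t. t \<in> {0<..<tf} - S \<Longrightarrow> (D has_vector_derivative cis (psi t)) (at t)"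
    "\<And>t. t \<in> {0<..<tf} - S \<Longrightarrow> (T has_vector_derivative of_real \<alpha> * cis (phi t)) (at t)"
    using evolution_derivatives[OF ev] by metis
  obtain t1 where t1: "0 \<le> t1" "t1 < tf" "\<And>t. t \<in> {t1..<tf} \<Longrightarrow> (V 0 + R) / 2 < dist (A t) (T t)"
  proof -
    have "continuous_on {0..tf} (\<lambda>t. dist (A t) (T t))"
      using evolution_continuous[OF ev] by (intro continuous_intros)
    then have "((\<lambda>t. dist (A t) (T t)) \<longlongrightarrow> R) (at tf within {0..tf})"
      using tf unfolding R_def continuous_on_def by simp
    moreover have "(V 0 + R) / 2 < R" using less by simp
    ultimately have "\<forall>\<^sub>F t in at tf within {0..tf}. (V 0 + R) / 2 < dist (A t) (T t)"
      by (rule order_tendstoD)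
    then obtain \<delta> where \<delta>: "0 < \<delta>"
      "\<And>t. t \<in> {0..tf} \<Longrightarrow> t \<noteq> tf \<Longrightarrow> dist t tf < \<delta> \<Longrightarrow> (V 0 + R) / 2 < dist (A t) (T t)"
      unfolding eventually_at by auto
    show ?thesis
      by (rule that[of "max 0 (tf - \<delta> / 2)"]) (use tf \<delta> in \<open>auto simp: dist_real_def\<close>)
  qed
  \<comment> \<open>A quarter, not a half, of the gap: for \<open>r < 0\<close> the detour
    \<open>\<bar>r\<bar>\<close> may itself be as long as the interception time, so
    \<open>dist_aim\<close> is shared by two equal parts.\<close>
  define \<tau>0 where "\<tau>0 = (R - V 0) / 4"
  have \<tau>0: "0 < \<tau>0" using less by (simp add: \<tau>0_def)
  define k where "k = (1 - \<alpha>\<^sup>2) / 4"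
  have k: "0 < k" using speed_ratio_sq_less_1 by (simp add: k_def)
  define K where "K = k * \<tau>0"
  have K: "0 < K" using k \<tau>0 by (simp add: K_def)
  \<comment> \<open>Its derivative is the negative of the bound in
    \<open>bending_rate_bound\<close>. Near \<open>tf\<close> the term in \<open>ln (N t)\<close>
    outweighs the one in \<open>ln (tf - t)\<close> by the factor 2.\<close>
  define penalty where "penalty t = - 2 * c * K * ln (N t) + c * K * ln (tf - t) - 2 * c * k * t" for t
  have decr: "V t + penalty t \<le> V t1 + penalty t1" if t: "t \<in> {t1..<tf}" for t
  proof (rule nonincreasing_if_support_below[where f = "\<lambda>t. V t + penalty t", OF _ _ S(1)])
    show "t1 \<le> t" using t by simp
    have sub: "{t1..t} \<subseteq> {0..<tf}" "{t1..t} \<subseteq> {0..tf}" using t t1 by auto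
    have cont: "continuous_on {t1..t} A" "continuous_on {t1..t} D" "continuous_on {t1..t} T"
      using evolution_continuous[OF ev] sub by (auto intro: continuous_on_subset)
    have neI: "A s \<noteq> D s" if "s \<in> {t1..t}" for s using ne sub that by blast
    have "continuous_on {t1..t} V"
      unfolding V_def using neI by (intro continuous_on_play_value cont)
    moreover have "continuous_on {t1..t} penalty"
      unfolding penalty_def N_def using neI t by (intro continuous_intros cont) auto
    ultimately show "continuous_on {t1..t} (\<lambda>t. V t + penalty t)" by (intro continuous_intros)
  next
    fix s assume s_in: "s \<in> {t1<..<t} - S"
    then have s: "s \<in> {0<..<tf} - S" "s \<in> {0..<tf}" "s \<in> {t1..<tf}" using t t1 by auto
    obtain \<beta> \<rho> r where aim: "aim \<alpha> \<beta> \<rho> r (dist (A s) (D s)) (target_frame (A s) (D s) (T s))"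
      using active_aim[OF act[OF s(2)]] by metis
    define n where "n = sgn (A s - D s)"
    define d where "d = cis (psi s) * cnj n"
    have N: "0 < N s" "N s = 2 * \<rho> * cos \<beta>" and \<beta>: "0 < cos \<beta>" and \<rho>: "0 < \<rho>"
      using aim ne[OF s(2)] by (auto simp: N_def aim_def)
    have d: "cmod d = 1" using ne[OF s(2)] by (simp add: d_def n_def norm_mult norm_sgn)
    have V_s: "V s = \<alpha> * \<rho> + r" using game_value_aim[OF aim] by (simp add: V_def)
    have "\<tau>0 \<le> \<rho>"
    proof -
      have "\<alpha> * \<rho> \<le> \<rho>" using \<alpha> \<rho> by (simp add: mult_left_le_one_le)
      moreover have "(V 0 + R) / 2 < \<rho> + \<bar>r\<bar>"
        using t1(3)[OF s(3)] dist_aim[OF ne[OF s(2)] aim] by linarith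
      moreover have "0 \<le> \<alpha> * \<rho>" using \<alpha> \<rho> by simp
      ultimately show ?thesis
        using V0[OF s(2)] V_nonneg[OF s(2)] V_nonneg[of 0] tf unfolding V_s \<tau>0_def by (auto split: abs_split)
    qed
    have "cis (chi s) = plane_direction (A s) (D s) (T s) (chis (reduced (A s) (D s) (T s)))"
      using chi s(2) by (simp add: follows_def)
    note rate = attacker_law_rate[OF laws act[OF s(2)] aim this, folded n_def]
    define g' where "g' = \<alpha> * Re (cis (phi s) * cnj n * cnj (retreat \<alpha> \<beta>))
       + attacker_rate \<alpha> \<beta> * Re (cis (chi s) * cnj n * cis \<beta>) + defender_rate \<alpha> \<beta> * Re (d * cnj (cis \<beta>))"
    have "Re ((cis (chi s) - cis (psi s)) * cnj n) = - cos \<beta> - Re d"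
      unfolding d_def left_diff_distrib rate(1) by simp
    then have N': "(N has_real_derivative - cos \<beta> - Re d) (at s)"
      using has_real_derivative_dist[OF S(2,3)[OF s(1)] ne[OF s(2)], folded n_def]
      unfolding N_def by simp
    have "g' \<le> - (k / cos \<beta>) * (1 - Re (d * cnj (cis \<beta>)))"
      using rate(2)[of "phi s" "psi s"] unfolding g'_def d_def k_def by simp
    also have "\<dots> \<le> 2 * c * (k * \<tau>0) * (- cos \<beta> - Re d) / N s + 2 * c * k + c * (k * \<tau>0) / (tf - s)"
      using bending_rate_bound[OF \<beta> N(2) \<tau>0 \<open>\<tau>0 \<le> \<rho>\<close> _ c(1) _ _ d, of k "tf - s"] k c(2)[of s] s by simp
    finally have total: "g' + (- 2 * c * K * ((- cos \<beta> - Re d) / N s) + c * K * (- 1 / (tf - s)) - 2 * c * k) \<le> 0"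
      by (simp add: K_def)
    show "\<exists>g g'. (g has_real_derivative g') (at s) \<and> g s = V s + penalty s
        \<and> (\<forall>u\<in>{t1..t}. g u \<le> V u + penalty u) \<and> g' \<le> 0"
    proof (intro exI conjI ballI)
      show "((\<lambda>u. payoff \<alpha> \<beta> (dist (A u) (D u)) (target_frame (A u) (D u) (T u)) + penalty u)
        has_real_derivative g' + (- 2 * c * K * ((- cos \<beta> - Re d) / N s) + c * K * (- 1 / (tf - s)) - 2 * c * k)) (at s)"
      proof (rule DERIV_add)
        show "((\<lambda>u. payoff \<alpha> \<beta> (dist (A u) (D u)) (target_frame (A u) (D u) (T u))) has_real_derivative g') (at s)"
          unfolding g'_def d_def n_def
          by (rule payoff_derivative_along_play[where A = A and D = D and T = T and chi = chi and psi = psi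
            and phi = phi and t = s, OF S(2-4)[OF s(1)] ne[OF s(2)] aim])
        show "(penalty has_real_derivative - 2 * c * K * ((- cos \<beta> - Re d) / N s) + c * K * (- 1 / (tf - s)) - 2 * c * k) (at s)"
          unfolding penalty_def using N s by (auto intro!: derivative_eq_intros N')
      qed
      show "payoff \<alpha> \<beta> (dist (A s) (D s)) (target_frame (A s) (D s) (T s)) + penalty s = V s + penalty s"
        using payoff_aim_self[OF aim] V_s by simp
    qed (use total payoff_le_game_value in \<open>auto simp: V_def\<close>)
  qed
  \<comment> \<open>Chosen so that monotonicity at time \<open>tf - h\<close> reads
    \<open>- ln h \<le> B\<close>, which the following choice of \<open>h\<close> violates.\<close>
  define B where "B = (V t1 + penalty t1 + 2 * c * K * ln 2 + 2 * c * k * tf) / (c * K)"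
  define h where "h = min (tf - t1) (exp (- B - 1))"
  have h: "0 < h" "h \<le> tf - t1" using t1 by (auto simp: h_def)
  have "ln h \<le> ln (exp (- B - 1))" using h(1) by (intro ln_mono) (auto simp: h_def)
  then have ln_h: "ln h \<le> - B - 1" by simp
  define t where "t = tf - h"
  have t: "t \<in> {t1..<tf}" "t \<in> {0..<tf}" "0 \<le> t" "t \<le> tf" using h t1 by (auto simp: t_def)
  have "N t \<le> 2 * h" using evolution_dist_bound[OF ev hit, of t] t by (simp add: N_def t_def)
  moreover have "0 < N t" using ne[OF t(2)] by (simp add: N_def)
  ultimately have "ln (N t) \<le> ln (2 * h)" by simp
  then have "ln (N t) \<le> ln 2 + ln h" using h by (simp add: ln_mult)
  then have "2 * c * K * ln (N t) \<le> 2 * c * K * (ln 2 + ln h)"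
    using c K by (intro mult_left_mono) auto
  moreover have "2 * c * k * t \<le> 2 * c * k * tf" using c k t by (intro mult_left_mono) auto
  ultimately have "- c * K * ln h \<le> V t1 + penalty t1 + 2 * c * K * ln 2 + 2 * c * k * tf"
    using decr[OF t(1)] V_nonneg[OF t(2)] by (simp add: penalty_def t_def algebra_simps)
  also have "\<dots> = c * K * B" using c K by (simp add: B_def)
  finally have "c * K * (- ln h) \<le> c * K * B" by simp
  then have "- ln h \<le> B" by (rule mult_left_le_imp_le) (use c K in simp)
  then show False using ln_h by simp
qed

section \<open>Optimal play and the saddle point\<close>

text \<open>A positive value means some positive payoff, hence escape. For \<alpha> = 0 every payoff
  equals \<open>- Re z\<close> for the frame position \<open>z\<close>, so a nonnegative value
  already puts the Target on the Defender's side.\<close>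

lemma active_if_game_value_nonneg:
  assumes "A \<noteq> D" and v: "0 \<le> game_value \<alpha> (dist A D) (target_frame A D T)"
    "0 < game_value \<alpha> (dist A D) (target_frame A D T) \<or> \<alpha> = 0"
  shows "active \<alpha> A D T"
proof (cases "\<exists>\<beta>. 0 < payoff \<alpha> \<beta> (dist A D) (target_frame A D T)")
  case True
  then show ?thesis using escape_if_payoff_pos_plane[OF assms(1)] by blast
next
  case False
  then have "game_value \<alpha> (dist A D) (target_frame A D T) \<le> 0"
    unfolding game_value_def by (intro cSUP_least) (auto simp: not_less)
  with v have "\<alpha> = 0" by simp
  then have "payoff \<alpha> \<beta> (dist A D) (target_frame A D T) = - Re (target_frame A D T)" for \<beta>
    by (simp add: payoff_def retreat_def lateral_def)
  then have "game_value \<alpha> (dist A D) (target_frame A D T) = - Re (target_frame A D T)"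
    by (simp add: game_value_def)
  then show ?thesis using v escape_if_payoff_pos_plane[OF assms(1)] by simp
qed

text \<open>Straight courses: after time \<open>t\<close> the same \<beta> is an aim with
  \<open>\<rho> - t\<close> and \<open>r + \<alpha> * t\<close>, so the feedback laws keep returning
  the initial headings and \<open>\<alpha> * \<rho> + r\<close> stays constant.\<close>

lemma equilibrium_play:
  assumes laws: "optimal_laws \<alpha> chis phis psis" and act: "active \<alpha> A0 D0 T0"
  defines "v \<equiv> game_value \<alpha> (dist A0 D0) (target_frame A0 D0 T0)"
  shows "\<exists>A D T chi psi phi tf. evolution \<alpha> A D T chi psi phi tf \<and> A 0 = A0 \<and> D 0 = D0 \<and> T 0 = T0 \<and>
    follows chis A D T chi tf \<and> follows psis A D T psi tf \<and> follows phis A D T phi tf \<and>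
    A tf = D tf \<and> nongrazing A D tf \<and> cost A T tf = v\<^sup>2 / 2"
proof -
  define n where "n = sgn (A0 - D0)"
  define z where "z = target_frame A0 D0 T0"
  obtain \<beta> \<rho> r where aim0: "aim \<alpha> \<beta> \<rho> r (dist A0 D0) z" and or: "Re z \<le> 0 \<or> 0 < \<alpha> * \<rho> + r"
    unfolding z_def by (rule active_aim[OF act])
  have ne: "A0 \<noteq> D0" using act by (simp add: active_def)
  have n: "cmod n = 1" "n * cnj n = 1"
    using ne by (auto simp: n_def norm_sgn complex_norm_square[symmetric])
  have \<beta>: "0 < cos \<beta>" and \<rho>: "0 < \<rho>" and N0: "dist A0 D0 = 2 * \<rho> * cos \<beta>"
    using aim0 by (auto simp: aim_def)
  have v: "v = \<alpha> * \<rho> + r" using game_value_aim[OF aim0] by (simp add: v_def z_def)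
  define wA where "wA = n * Complex (- cos \<beta>) (sin \<beta>)"
  define wD where "wD = n * cis \<beta>"
  define wT where "wT = n * retreat \<alpha> \<beta>"
  define A where "A t = A0 + of_real t * wA" for t
  define D where "D t = D0 + of_real t * wD" for t
  define T where "T t = T0 + of_real (\<alpha> * t) * wT" for t
  have "cmod (Complex (- cos \<beta>) (sin \<beta>)) = 1" by (simp add: cmod_def)
  then have "cmod wA = 1" "cmod wD = 1" "cmod wT = 1"
    using n by (auto simp: wA_def wD_def wT_def norm_mult norm_retreat)
  then obtain hA hD hT where h: "hA \<in> {- pi..pi}" "hD \<in> {- pi..pi}" "hT \<in> {- pi..pi}"
    "cis hA = wA" "cis hD = wD" "cis hT = wT" by (metis heading_exists)
  have AD0: "A0 - D0 = of_real (dist A0 D0) * n" using ne by (simp add: n_def sgn_eq dist_norm)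
  have AD: "A t - D t = of_real (2 * (\<rho> - t) * cos \<beta>) * n" for t
  proof -
    have "A t - D t = (A0 - D0) + of_real t * (Complex (- cos \<beta>) (sin \<beta>) - cis \<beta>) * n"
      by (simp add: A_def D_def wA_def wD_def algebra_simps)
    also have "Complex (- cos \<beta>) (sin \<beta>) - cis \<beta> = of_real (- 2 * cos \<beta>)" by (simp add: complex_eq_iff)
    finally show ?thesis unfolding AD0 N0 by (simp add: algebra_simps)
  qed
  have T0: "T0 - (A0 + D0) / 2 = z * n"
  proof -
    have "z * n = (T0 - (A0 + D0) / 2) * (n * cnj n)" by (simp only: z_def target_frame_def n_def mult_ac)
    then show ?thesis unfolding n(2) by simp
  qed
  have z_eq: "z = Complex 0 (\<rho> * sin \<beta>) + of_real r * retreat \<alpha> \<beta>" using aim0 by (simp add: aim_def)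
  have mid: "T t - (A t + D t) / 2 = (Complex 0 ((\<rho> - t) * sin \<beta>) + of_real (r + \<alpha> * t) * retreat \<alpha> \<beta>) * n" for t
  proof -
    have "T t - (A t + D t) / 2 = (T0 - (A0 + D0) / 2)
        + (of_real (\<alpha> * t) * retreat \<alpha> \<beta> - of_real t * ((Complex (- cos \<beta>) (sin \<beta>) + cis \<beta>) / 2)) * n"
      by (simp add: A_def D_def T_def wA_def wD_def wT_def field_simps)
    also have "(Complex (- cos \<beta>) (sin \<beta>) + cis \<beta>) / 2 = Complex 0 (sin \<beta>)" by (simp add: complex_eq_iff)
    also have "T0 - (A0 + D0) / 2 = z * n" by (rule T0)
    finally have "T t - (A t + D t) / 2
      = (z + (of_real (\<alpha> * t) * retreat \<alpha> \<beta> - of_real t * Complex 0 (sin \<beta>))) * n"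
      by (simp add: algebra_simps)
    also have "z + (of_real (\<alpha> * t) * retreat \<alpha> \<beta> - of_real t * Complex 0 (sin \<beta>))
      = Complex 0 ((\<rho> - t) * sin \<beta>) + of_real (r + \<alpha> * t) * retreat \<alpha> \<beta>"
      unfolding z_eq by (simp add: complex_eq_iff algebra_simps)
    finally show ?thesis .
  qed
  have dist: "dist (A t) (D t) = 2 * (\<rho> - t) * cos \<beta>" if "t \<le> \<rho>" for t
    unfolding dist_norm AD norm_mult norm_of_real n(1) using that \<beta> by simp
  have sgn: "sgn (A t - D t) = n" if "t < \<rho>" for t
  proof -
    have "sgn (of_real (2 * (\<rho> - t) * cos \<beta>) * n) = n"
      unfolding sgn_mult sgn_of_real using that \<beta> by (simp add: n_def sgn_mult)
    then show ?thesis unfolding AD .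
  qed
  have frame: "target_frame (A t) (D t) (T t)
      = Complex 0 ((\<rho> - t) * sin \<beta>) + of_real (r + \<alpha> * t) * retreat \<alpha> \<beta>" if "t < \<rho>" for t
    unfolding target_frame_def sgn[OF that] mid mult.assoc n(2) by simp
  have aim: "aim \<alpha> \<beta> (\<rho> - t) (r + \<alpha> * t) (dist (A t) (D t)) (target_frame (A t) (D t) (T t))"
    if "0 \<le> t" "t < \<rho>" for t
    unfolding aim_def frame[OF that(2)] dist[OF less_imp_le[OF that(2)]]
    using aim0 that by (simp add: aim_def algebra_simps)
  have active: "active \<alpha> (A t) (D t) (T t)" if t: "0 \<le> t" "t < \<rho>" for t
  proof (rule escape_if_payoff_pos_plane)
    show "A t \<noteq> D t" using dist[of t] t \<beta> by auto
    show "0 < payoff \<alpha> \<beta> (dist (A t) (D t)) (target_frame (A t) (D t) (T t)) \<or> Re (target_frame (A t) (D t) (T t)) \<le> 0"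
    proof (cases "Re z \<le> 0")
      case True
      then have "0 \<le> r" using Im_aim(3)[OF aim0] lateral_pos[of \<beta>] by (simp add: zero_le_mult_iff)
      then have "0 \<le> (r + \<alpha> * t) * lateral \<alpha> \<beta>" using t \<alpha> lateral_pos[of \<beta>] by simp
      then show ?thesis using Im_aim(3)[OF aim[OF t]] by (simp add: algebra_simps)
    next
      case False
      then show ?thesis using payoff_aim_self[OF aim[OF t]] or by (simp add: algebra_simps)
    qed
  qed
  have "evolution \<alpha> A D T (\<lambda>_. hA) (\<lambda>_. hD) (\<lambda>_. hT) \<rho>"
    unfolding evolution_def simple_motion_def
  proof (intro conjI ballI allI exI[of _ "{}"])
    fix t :: real
    show "(A has_vector_derivative of_real 1 * cis hA) (at t)"
      "(D has_vector_derivative of_real 1 * cis hD) (at t)"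
      "(T has_vector_derivative of_real \<alpha> * cis hT) (at t)"
      unfolding A_def D_def T_def h by (auto intro!: derivative_eq_intros)
  qed (use h \<rho> active in \<open>auto simp: A_def D_def T_def intro!: continuous_intros\<close>)
  moreover have "A 0 = A0" "D 0 = D0" "T 0 = T0" by (auto simp: A_def D_def T_def)
  moreover have "follows chis A D T (\<lambda>_. hA) \<rho>" "follows psis A D T (\<lambda>_. hD) \<rho>" "follows phis A D T (\<lambda>_. hT) \<rho>"
    using optimal_lawsD[OF laws active aim] sgn by (auto simp: follows_def h wA_def wD_def wT_def)
  moreover have "A \<rho> = D \<rho>" using AD[of \<rho>] by simp
  moreover have "nongrazing A D \<rho>"
    unfolding nongrazing_def using \<beta> dist by (intro exI[of _ "2 * cos \<beta>"]) (auto simp: algebra_simps)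
  moreover have "cost A T \<rho> = v\<^sup>2 / 2"
  proof -
    \<comment> \<open>At the meeting time there is no frame any more, but \<open>mid\<close> refers
      to the fixed direction \<open>n\<close> and still holds.\<close>
    have "T \<rho> - A \<rho> = of_real v * (retreat \<alpha> \<beta> * n)"
      using mid[of \<rho>] \<open>A \<rho> = D \<rho>\<close> by (simp add: v Complex_eq_0 algebra_simps)
    then have "dist (A \<rho>) (T \<rho>) = \<bar>v\<bar>"
      by (simp add: dist_norm norm_minus_commute[of "A \<rho>"] norm_mult norm_retreat n)
    then show ?thesis by (simp add: cost_eq_dist)
  qed
  ultimately show ?thesis by blast
qed

text \<open>The value is at most \<open>m\<close>, the sum of \<alpha> times half the distance of
  \<open>A\<close> and \<open>D\<close> and the distance of \<open>T\<close> from their midpoint.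
  Unlike the value, \<open>m\<close> is continuous up to the meeting, where it equals the terminal
  distance.\<close>

lemma play_value_le_terminal_dist:
  assumes laws: "optimal_laws \<alpha> chis phis psis" and ev: "evolution \<alpha> A D T chi psi phi tf"
    and D: "follows psis A D T psi tf" and T: "follows phis A D T phi tf" and hit: "A tf = D tf"
  shows "play_value \<alpha> A D T 0 \<le> dist (A tf) (T tf)"
proof (rule tendsto_le[OF _ _ tendsto_const])
  define m where "m t = \<bar>dist (A t) (D t)\<bar> / 2 * \<alpha> + dist (T t) ((A t + D t) / 2)" for t
  have tf: "0 < tf" using ev by (simp add: evolution_def)
  have "continuous_on {0..tf} m"
    unfolding m_def using evolution_continuous[OF ev] by (intro continuous_intros) auto
  then have "(m \<longlongrightarrow> m tf) (at tf within {0..tf})" using tf by (simp add: continuous_on_def)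
  then have "(m \<longlongrightarrow> m tf) (at_left tf)"
    using tf by (simp add: at_within_Icc_at_left)
  moreover have "m tf = dist (A tf) (T tf)" using hit by (simp add: m_def dist_commute)
  ultimately show "(m \<longlongrightarrow> dist (A tf) (T tf)) (at_left tf)" by simp
  show "\<forall>\<^sub>F t in at_left tf. play_value \<alpha> A D T 0 \<le> m t"
    unfolding eventually_at_left_field
  proof (intro exI[of _ 0] conjI allI impI tf)
    fix t assume t: "0 < t" "t < tf"
    then have act: "active \<alpha> (A t) (D t) (T t)" using ev by (simp add: evolution_def)
    then have ne: "A t \<noteq> D t" by (simp add: active_def)
    obtain \<beta> \<rho> r where aim: "aim \<alpha> \<beta> \<rho> r (dist (A t) (D t)) (target_frame (A t) (D t) (T t))"
      using active_aim[OF act] by metis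
    have "play_value \<alpha> A D T 0 \<le> play_value \<alpha> A D T t"
      using play_value_nondecreasing[OF laws ev D T] t ne by simp
    also have "\<dots> = payoff \<alpha> \<beta> (dist (A t) (D t)) (target_frame (A t) (D t) (T t))"
      using payoff_aim_self[OF aim] game_value_aim[OF aim] by simp
    also have "\<dots> \<le> m t"
    proof -
      have "cmod (target_frame (A t) (D t) (T t) * cnj (retreat \<alpha> \<beta>)) = dist (T t) ((A t + D t) / 2)"
        using ne by (simp add: target_frame_def norm_mult norm_retreat norm_sgn dist_norm)
      then have "Re (target_frame (A t) (D t) (T t) * cnj (retreat \<alpha> \<beta>)) \<le> dist (T t) ((A t + D t) / 2)"
        using complex_Re_le_cmod by metis
      moreover have "\<alpha> * dist (A t) (D t) / 2 * cos \<beta> \<le> \<alpha> * dist (A t) (D t) / 2"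
        using \<alpha> by (intro mult_left_le) auto
      ultimately show ?thesis by (simp add: payoff_def m_def mult_ac)
    qed
    finally show "play_value \<alpha> A D T 0 \<le> m t" .
  qed
qed (simp add: trivial_limit_at_left_real)

lemma optimal_laws_optimal_headings:
  assumes laws: "optimal_laws \<alpha> chis phis psis"
  shows "optimal_headings \<alpha> chis phis psis"
  unfolding optimal_headings_def
proof (intro allI impI)
  fix A0 D0 T0
  assume act0: "active \<alpha> A0 D0 T0"
  define v where "v = game_value \<alpha> (dist A0 D0) (target_frame A0 D0 T0)"
  \<comment> \<open>For \<alpha> > 0 the region is open at the boundary where the value vanishes, so
    staying inside requires strict positivity; a Target with \<open>Re \<le> 0\<close> has
    \<open>r \<ge> 0\<close> and thus at least \<open>\<alpha> * \<rho>\<close>.\<close>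
  have v: "0 \<le> v" "0 < v \<or> \<alpha> = 0"
  proof -
    obtain \<beta> \<rho> r where aim: "aim \<alpha> \<beta> \<rho> r (dist A0 D0) (target_frame A0 D0 T0)"
      and or: "Re (target_frame A0 D0 T0) \<le> 0 \<or> 0 < \<alpha> * \<rho> + r"
      by (rule active_aim[OF act0])
    have v_eq: "v = \<alpha> * \<rho> + r" using game_value_aim[OF aim] by (simp add: v_def)
    then show "0 \<le> v" using aim by (simp add: aim_def)
    show "0 < v \<or> \<alpha> = 0"
    proof (cases "Re (target_frame A0 D0 T0) \<le> 0")
      case True
      then have "0 \<le> r" using Im_aim(3)[OF aim] lateral_pos[of \<beta>] by (simp add: zero_le_mult_iff)
      moreover have "0 < \<rho>" using aim by (simp add: aim_def)
      ultimately show ?thesis using \<alpha> by (cases "\<alpha> = 0") (auto simp: v_eq add_pos_nonneg)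
    next
      case False
      then show ?thesis using or v_eq by simp
    qed
  qed
  show "\<exists>J.
         (\<exists>A D T chi psi phi tf.
            evolution \<alpha> A D T chi psi phi tf \<and> A 0 = A0 \<and> D 0 = D0 \<and> T 0 = T0 \<and>
            follows chis A D T chi tf \<and> follows psis A D T psi tf \<and> follows phis A D T phi tf \<and>
            A tf = D tf \<and> nongrazing A D tf \<and> cost A T tf = J) \<and>
         (\<forall>A D T chi psi phi tf.
            evolution \<alpha> A D T chi psi phi tf \<and> A 0 = A0 \<and> D 0 = D0 \<and> T 0 = T0 \<and>
            follows chis A D T chi tf \<and> A tf = D tf \<and> nongrazing A D tf \<longrightarrow>
            cost A T tf \<le> J) \<and>
         (\<forall>A D T chi psi phi tf.
            evolution \<alpha> A D T chi psi phi tf \<and> A 0 = A0 \<and> D 0 = D0 \<and> T 0 = T0 \<and>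
            follows psis A D T psi tf \<and> follows phis A D T phi tf \<and> A tf = D tf \<longrightarrow>
            J \<le> cost A T tf) \<and>
         (\<forall>A D T chi psi phi \<tau>.
            evolution \<alpha> A D T chi psi phi \<tau> \<and> A 0 = A0 \<and> D 0 = D0 \<and> T 0 = T0 \<and>
            follows psis A D T psi \<tau> \<and> follows phis A D T phi \<tau> \<longrightarrow>
            A \<tau> = D \<tau> \<or> active \<alpha> (A \<tau>) (D \<tau>) (T \<tau>))"
  proof (intro exI[of _ "v\<^sup>2 / 2"] conjI allI impI; (elim conjE)?)
    show "\<exists>A D T chi psi phi tf.
            evolution \<alpha> A D T chi psi phi tf \<and> A 0 = A0 \<and> D 0 = D0 \<and> T 0 = T0 \<and>
            follows chis A D T chi tf \<and> follows psis A D T psi tf \<and> follows phis A D T phi tf \<and>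
            A tf = D tf \<and> nongrazing A D tf \<and> cost A T tf = v\<^sup>2 / 2"
      unfolding v_def by (rule equilibrium_play[OF laws act0])
  next
    fix A D T chi psi phi tf
    assume "evolution \<alpha> A D T chi psi phi tf" "follows chis A D T chi tf" "A tf = D tf" "nongrazing A D tf"
      and init: "A 0 = A0" "D 0 = D0" "T 0 = T0"
    then have "dist (A tf) (T tf) \<le> v"
      using terminal_dist_le_play_value[OF laws] unfolding v_def init[symmetric] by blast
    then show "cost A T tf \<le> v\<^sup>2 / 2" by (simp add: cost_eq_dist power_mono)
  next
    fix A D T chi psi phi tf
    assume "evolution \<alpha> A D T chi psi phi tf" "follows psis A D T psi tf" "follows phis A D T phi tf" "A tf = D tf"
      and init: "A 0 = A0" "D 0 = D0" "T 0 = T0"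
    then have "v \<le> dist (A tf) (T tf)"
      using play_value_le_terminal_dist[OF laws] unfolding v_def init[symmetric] by blast
    then show "v\<^sup>2 / 2 \<le> cost A T tf" using v by (simp add: cost_eq_dist power_mono)
  next
    fix A D T chi psi phi \<tau>
    assume ev: "evolution \<alpha> A D T chi psi phi \<tau>"
      and fol: "follows psis A D T psi \<tau>" "follows phis A D T phi \<tau>"
      and init: "A 0 = A0" "D 0 = D0" "T 0 = T0"
    have "active \<alpha> (A \<tau>) (D \<tau>) (T \<tau>)" if "A \<tau> \<noteq> D \<tau>"
    proof (rule active_if_game_value_nonneg[OF that])
      have "0 < \<tau>" using ev by (simp add: evolution_def)
      then have "v \<le> play_value \<alpha> A D T \<tau>"
        using play_value_nondecreasing[OF laws ev fol _ _ that] unfolding v_def init[symmetric] by simp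
      then show "0 \<le> play_value \<alpha> A D T \<tau>" "0 < play_value \<alpha> A D T \<tau> \<or> \<alpha> = 0" using v by auto
    qed
    then show "A \<tau> = D \<tau> \<or> active \<alpha> (A \<tau>) (D \<tau>) (T \<tau>)" by blast
  qed
qed

end

theorem theorem3:
  fixes \<alpha> :: real
  assumes "0 \<le> \<alpha>" and "\<alpha> < 1"
  shows "\<exists>y1 y2 :: real \<times> real \<times> real \<Rightarrow> real.
    (\<forall>xA xT yT. 0 < xA \<and> 0 \<le> yT \<longrightarrow>
       {y. 0 \<le> y \<and> quartic \<alpha> (xA, xT, yT) y = 0} = {y1 (xA, xT, yT), y2 (xA, xT, yT)} \<and>
       y1 (xA, xT, yT) \<le> yT \<and> yT \<le> y2 (xA, xT, yT)) \<and>
    (\<exists>chi phi psi. \<forall>xA xT yT. 0 < xA \<and> 0 \<le> yT \<and> (xA, xT, yT) \<in> escape_region \<alpha> \<longrightarrow>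
       control_laws \<alpha> y1 y2 chi phi psi (xA, xT, yT)) \<and>
    (\<forall>chi phi psi. (\<forall>xA xT yT. 0 < xA \<and> 0 \<le> yT \<and> (xA, xT, yT) \<in> escape_region \<alpha> \<longrightarrow>
         control_laws \<alpha> y1 y2 chi phi psi (xA, xT, yT)) \<longrightarrow>
       optimal_headings \<alpha> chi phi psi)"
proof -
  define P where "P s y \<longleftrightarrow> {u. 0 \<le> u \<and> quartic \<alpha> s u = 0} = {fst y, snd y} \<and>
    fst y \<le> snd (snd s) \<and> snd (snd s) \<le> snd y" for s :: "real \<times> real \<times> real" and y
  have "\<forall>s. \<exists>y. 0 < fst s \<and> 0 \<le> snd (snd s) \<longrightarrow> P s y"
  proof
    fix s :: "real \<times> real \<times> real"
    obtain xA xT yT where "s = (xA, xT, yT)" by (cases s)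
    then show "\<exists>y. 0 < fst s \<and> 0 \<le> snd (snd s) \<longrightarrow> P s y"
      using quartic_roots[OF assms, of xA yT xT] by (auto simp: P_def)
  qed
  then obtain y where y: "\<And>s. 0 < fst s \<and> 0 \<le> snd (snd s) \<longrightarrow> P s (y s)" by metis
  define y1 where "y1 s = fst (y s)" for s
  define y2 where "y2 s = snd (y s)" for s
  have roots: "\<forall>xA xT yT. 0 < xA \<and> 0 \<le> yT \<longrightarrow>
       {y. 0 \<le> y \<and> quartic \<alpha> (xA, xT, yT) y = 0} = {y1 (xA, xT, yT), y2 (xA, xT, yT)} \<and>
       y1 (xA, xT, yT) \<le> yT \<and> yT \<le> y2 (xA, xT, yT)"
  proof (intro allI impI)
    fix xA xT yT :: real
    assume "0 < xA \<and> 0 \<le> yT"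
    then have "P (xA, xT, yT) (y (xA, xT, yT))" using y[of "(xA, xT, yT)"] by simp
    then show "{y. 0 \<le> y \<and> quartic \<alpha> (xA, xT, yT) y = 0} = {y1 (xA, xT, yT), y2 (xA, xT, yT)} \<and>
       y1 (xA, xT, yT) \<le> yT \<and> yT \<le> y2 (xA, xT, yT)"
      unfolding P_def y1_def y2_def by simp
  qed
  show ?thesis
  proof (rule exI[of _ y1], rule exI[of _ y2], intro conjI)
    show "\<exists>chi phi psi. \<forall>xA xT yT. 0 < xA \<and> 0 \<le> yT \<and> (xA, xT, yT) \<in> escape_region \<alpha> \<longrightarrow>
       control_laws \<alpha> y1 y2 chi phi psi (xA, xT, yT)"
      using control_laws_exist[OF assms, of y1 y2] by blast
    show "\<forall>chi phi psi. (\<forall>xA xT yT. 0 < xA \<and> 0 \<le> yT \<and> (xA, xT, yT) \<in> escape_region \<alpha> \<longrightarrow>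
         control_laws \<alpha> y1 y2 chi phi psi (xA, xT, yT)) \<longrightarrow> optimal_headings \<alpha> chi phi psi"
      using control_laws_optimal_laws[OF assms roots] optimal_laws_optimal_headings[OF assms] by blast
  qed (fact roots)
qed

end
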